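(* Let $\Gamma$ be a confusion graph and $\Theta$ an approximation graph on the same finite source alphabet $\mathcal{X}$, and let $g$ be a guessing capability function. Then the multi-approximate-guess maximal leakage rate $\mathcal{L}_{\Theta,g}$ satisfies $$\log\frac{p_f(\Theta)}{\max_{T\in\mathcal{I}_{\max}(\Gamma)}k_f(\mathcal{H}_1(T))}\le\mathcal{L}_{\Theta,g}\le\log\chi_f(\Gamma).$$
   Context: Graphs are finite, simple and undirected. The confusion graph $\Gamma$ and the adversary's approximation graph $\Theta$ both have vertex set $\mathcal{X}$, the finite alphabet of a discrete memoryless stationary source (so $P_{X^t}(x^t)=\prod_jP_X(x_j)$). For a positive integer $t$, $\Gamma_t=\Gamma^{\lor t}$ is the graph on $\mathcal{X}^t$ in which $x^t,v^t$ are adjacent iff $\{x_j,v_j\}$ is an edge of $\Gamma$ for some $j$. $\Theta_t=\Theta^{\boxtimes t}$ is the graph on $\mathcal{X}^t$ in which distinct $x^t,v^t$ are adjacent iff for every $j$, $x_j=v_j$ or $\{x_j,v_j\}$ is an edge of $\Theta$. $N(\Theta_t,x^t)$ is the closed neighborhood of $x^t$ in $\Theta_t$ (including $x^t$), $N(\Theta_t,K)=\bigcup_{x^t\in K}N(\Theta_t,x^t)$, and $\Theta_1=\Theta$. $\mathcal{I}_{\max}(G)$ is the set of inclusion-maximal independent sets of $G$. For $T\in\mathcal{I}_{\max}(\Gamma_t)$, the associated hypergraph $\mathcal{H}_t(T)$ has vertex set $T$ and hyperedges all nonempty sets of the form $T\cap N(\Theta_t,x^t)$ with $x^t\in\mathcal{X}^t$.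 For a hypergraph $\mathcal{H}$, the covering number $k(\mathcal{H})$ is the least number of hyperedges whose union is the vertex set; a $b$-fold covering is a multiset of hyperedges such that every vertex is in at least $b$ of them; $k_b(\mathcal{H})$ is the least cardinality (with multiplicity) of a $b$-fold covering, and $k_f(\mathcal{H})=\inf_bk_b(\mathcal{H})/b$ is the fractional covering number. A guessing capability function is here a non-decreasing function $g$ from the positive integers to the positive integers with $g(t)\le\max_{T\in\mathcal{I}_{\max}(\Gamma_t)}k(\mathcal{H}_t(T))$ for all $t$. A mapping scheme is a conditional distribution $P_{Y|X^t}$ from $\mathcal{X}^t$ to a finite code alphabet $\mathcal{Y}$ (which may be chosen freely); it is valid if for every $y$ the set $\{x^t: P_{Y|X^t}(y|x^t)>0\}$ is an independent set of $\Gamma_t$. The multi-approximate-guess maximal leakage of a valid mapping is $$L^t_{\Theta,g}(P_{Y|X^t})=\log\max_{P_X}\frac{\sum_{y\in\mathcal{Y}}\max_{K\subseteq\mathcal{X}^t,|K|=g(t)}\sum_{x^t\in N(\Theta_t,K)}P_{X^t}(x^t)P_{Y|X^t}(y|x^t)}{\max_{K\subseteq\mathcal{X}^t,|K|=g(t)}\sum_{x^t\in N(\Theta_t,K)}P_{X^t}(x^t)},$$ the outer maximum being over all probability distributions $P_X$ on $\mathcal{X}$. The multi-approximate-guess maximal leakage rate is $\mathcal{L}_{\Theta,g}=\lim_{t\to\infty}\frac1t\inf L^t_{\Theta,g}(P_{Y|X^t})$, the infimum being over valid mappings for length $t$; the limit is assumed to exist. The fractional closed neighborhood packing number $p_f(\Theta)$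 is the maximum of $\sum_{x\in\mathcal{X}}\lambda(x)$ over $\lambda:\mathcal{X}\to[0,1]$ with $\sum_{\tilde x\in N(\Theta,x)}\lambda(\tilde x)\le1$ for every $x\in\mathcal{X}$. The fractional chromatic number is $\chi_f(G)=\inf_b\chi_b(G)/b$, where $\chi_b(G)$ is the least $m$ for which there is a multiset of $m$ independent sets of $G$ with every vertex in exactly $b$ of them. The logarithm has a fixed base greater than 1. *)

theory Defs
  imports "HOL-Probability.Probability_Mass_Function" "HOL-Library.Multiset"
begin

record 'a sgraph =
  vset :: "'a set"
  adj :: "'a \<Rightarrow> 'a \<Rightarrow> bool"

definition simple_graph :: "'a sgraph \<Rightarrow> bool" where
  "simple_graph G \<longleftrightarrow> finite (vset G) \<and>
     (\<forall>x y. adj G x y \<longrightarrow> x \<in> vset G \<and> y \<in> vset G \<and> x \<noteq> y \<and> adj G y x)"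

definition closed_nbhd :: "'a sgraph \<Rightarrow> 'a \<Rightarrow> 'a set" where
  "closed_nbhd G x = {y \<in> vset G. y = x \<or> adj G x y}"

definition closed_nbhd_set :: "'a sgraph \<Rightarrow> 'a set \<Rightarrow> 'a set" where
  "closed_nbhd_set G K = (\<Union>x\<in>K. closed_nbhd G x)"

definition indep_set :: "'a sgraph \<Rightarrow> 'a set \<Rightarrow> bool" where
  "indep_set G S \<longleftrightarrow> S \<subseteq> vset G \<and> (\<forall>x\<in>S. \<forall>y\<in>S. \<not> adj G x y)"

definition max_indep_sets :: "'a sgraph \<Rightarrow> 'a set set" where
  "max_indep_sets G = {S. indep_set G S \<and> (\<forall>S'. indep_set G S' \<and> S \<subseteq> S' \<longrightarrow> S' = S)}"

text \<open>Elements of the \<open>t\<close>-th power of a set are represented as lists of length \<open>t\<close>.\<close>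

definition words :: "'a set \<Rightarrow> nat \<Rightarrow> 'a list set" where
  "words X t = {xs. length xs = t \<and> set xs \<subseteq> X}"

definition or_power :: "'a sgraph \<Rightarrow> nat \<Rightarrow> 'a list sgraph" where
  "or_power G t = \<lparr> vset = words (vset G) t,
     adj = (\<lambda>xs vs. xs \<in> words (vset G) t \<and> vs \<in> words (vset G) t \<and>
              (\<exists>j<t. adj G (xs ! j) (vs ! j))) \<rparr>"

definition strong_power :: "'a sgraph \<Rightarrow> nat \<Rightarrow> 'a list sgraph" where
  "strong_power G t = \<lparr> vset = words (vset G) t,
     adj = (\<lambda>xs vs. xs \<in> words (vset G) t \<and> vs \<in> words (vset G) t \<and> xs \<noteq> vs \<and>
              (\<forall>j<t. xs ! j = vs ! j \<or> adj G (xs ! j) (vs ! j))) \<rparr>"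

definition chi_fold :: "'a sgraph \<Rightarrow> nat \<Rightarrow> nat" where
  "chi_fold G b = (LEAST m. \<exists>M :: 'a set multiset. size M = m \<and>
     (\<forall>S\<in>#M. indep_set G S) \<and> (\<forall>v\<in>vset G. size {#S \<in># M. v \<in> S#} = b))"

definition chi_frac :: "'a sgraph \<Rightarrow> real" where
  "chi_frac G = (INF b\<in>{1..}. real (chi_fold G b) / real b)"

text \<open>The maximum in the linear program below is attained, so it is written as a supremum.\<close>

definition frac_packing :: "'a sgraph \<Rightarrow> real" where
  "frac_packing G = Sup {\<Sum>x\<in>vset G. l x | l :: 'a \<Rightarrow> real.
     (\<forall>x\<in>vset G. 0 \<le> l x \<and> l x \<le> 1) \<and>
     (\<forall>x\<in>vset G. (\<Sum>y\<in>closed_nbhd G x. l y) \<le> 1)}"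

text \<open>A hypergraph is a pair consisting of its vertex set and its set of hyperedges.\<close>

type_synonym 'a hypergraph = "'a set \<times> 'a set set"

definition cover_num :: "'a hypergraph \<Rightarrow> nat" where
  "cover_num H = (LEAST n. \<exists>F. F \<subseteq> snd H \<and> finite F \<and> card F = n \<and> \<Union>F = fst H)"

definition fold_cover_num :: "'a hypergraph \<Rightarrow> nat \<Rightarrow> nat" where
  "fold_cover_num H b = (LEAST n. \<exists>M. size M = n \<and> set_mset M \<subseteq> snd H \<and>
     (\<forall>v\<in>fst H. b \<le> size {#e \<in># M. v \<in> e#}))"

definition frac_cover_num :: "'a hypergraph \<Rightarrow> real" where
  "frac_cover_num H = (INF b\<in>{1..}. real (fold_cover_num H b) / real b)"

definition assoc_hypergraph :: "'a sgraph \<Rightarrow> 'a set \<Rightarrow> 'a hypergraph" where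
  "assoc_hypergraph G T = (T, {T \<inter> closed_nbhd G x | x. x \<in> vset G} - {{}})"

definition guessing_capability :: "'a sgraph \<Rightarrow> 'a sgraph \<Rightarrow> (nat \<Rightarrow> nat) \<Rightarrow> bool" where
  "guessing_capability \<Gamma> \<Theta> g \<longleftrightarrow> mono_on {1..} g \<and>
     (\<forall>t\<ge>1. 1 \<le> g t \<and>
        g t \<le> Max ((\<lambda>T. cover_num (assoc_hypergraph (strong_power \<Theta> t) T))
                      ` max_indep_sets (or_power \<Gamma> t)))"

definition word_prob :: "'a pmf \<Rightarrow> 'a list \<Rightarrow> real" where
  "word_prob p xs = (\<Prod>j<length xs. pmf p (xs ! j))"

text \<open>Code alphabets are finite sets of natural numbers; since only the cardinality of the
  alphabet matters, this covers all finite alphabets. The kernel \<open>W\<close> is only relevant on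
  words of length \<open>t\<close> over the source alphabet.\<close>

definition valid_mapping :: "'a sgraph \<Rightarrow> nat \<Rightarrow> nat set \<Rightarrow> ('a list \<Rightarrow> nat pmf) \<Rightarrow> bool" where
  "valid_mapping \<Gamma> t Y W \<longleftrightarrow> finite Y \<and>
     (\<forall>xs\<in>words (vset \<Gamma>) t. set_pmf (W xs) \<subseteq> Y) \<and>
     (\<forall>y\<in>Y. indep_set (or_power \<Gamma> t) {xs \<in> words (vset \<Gamma>) t. pmf (W xs) y > 0})"

definition guess_sets :: "'a sgraph \<Rightarrow> nat \<Rightarrow> nat \<Rightarrow> 'a list set set" where
  "guess_sets \<Theta> t n = {K. K \<subseteq> words (vset \<Theta>) t \<and> card K = n}"

text \<open>The ratio is continuous on the compact simplex of source distributions (its denominator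
  is positive there), so the maximum over source distributions is written as a supremum.\<close>

definition leakage ::
  "real \<Rightarrow> 'a sgraph \<Rightarrow> (nat \<Rightarrow> nat) \<Rightarrow> nat \<Rightarrow> nat set \<Rightarrow> ('a list \<Rightarrow> nat pmf) \<Rightarrow> real" where
  "leakage c \<Theta> g t Y W = log c (SUP p\<in>{p. set_pmf p \<subseteq> vset \<Theta>}.
     (\<Sum>y\<in>Y. Max ((\<lambda>K. \<Sum>xs\<in>closed_nbhd_set (strong_power \<Theta> t) K. word_prob p xs * pmf (W xs) y)
                    ` guess_sets \<Theta> t (g t))) /
     Max ((\<lambda>K. \<Sum>xs\<in>closed_nbhd_set (strong_power \<Theta> t) K. word_prob p xs)
            ` guess_sets \<Theta> t (g t)))"

definition normalized_leakage ::
  "real \<Rightarrow> 'a sgraph \<Rightarrow> 'a sgraph \<Rightarrow> (nat \<Rightarrow> nat) \<Rightarrow> nat \<Rightarrow> real" where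
  "normalized_leakage c \<Gamma> \<Theta> g t =
     1 / real t * Inf {leakage c \<Theta> g t Y W | Y W. valid_mapping \<Gamma> t Y W}"

definition leakage_rate ::
  "real \<Rightarrow> 'a sgraph \<Rightarrow> 'a sgraph \<Rightarrow> (nat \<Rightarrow> nat) \<Rightarrow> real" where
  "leakage_rate c \<Gamma> \<Theta> g = lim (normalized_leakage c \<Gamma> \<Theta> g)"

end

theory Submission
  imports Defs "HOL-Real_Asymp.Real_Asymp"
begin

text \<open>
  Upper bound: if \<open>m\<close> independent sets cover every vertex exactly \<open>b\<close> times, sending \<open>xs\<close> to a
  uniformly chosen \<open>t\<close>-tuple of sets containing its letters is a valid mapping, and every code
  symbol has conditional probability at most \<open>b\<^sup>-\<^sup>t\<close>, so the leakage is at most \<open>t log (m / b)\<close>.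

  Lower bound: choose the source distribution proportional to a fractional packing \<open>l\<close> of total
  weight \<open>s\<close>. Then \<open>g\<close> guesses capture mass at most \<open>g / s\<^sup>t\<close> without observation. Given a code
  symbol, the source word lies in some maximal independent set \<open>T\<close> of the \<open>t\<close>-th power; covering
  \<open>T\<close> by \<open>k\<close> neighborhoods and keeping the \<open>g\<close> heaviest of them captures at least the fraction
  \<open>g / k\<close>. Hence the ratio is at least \<open>s\<^sup>t / k\<close>. Since \<open>T\<close> lies in a product of maximal
  independent sets, products of fractional covers and the greedy bound of Lovasz (an integral
  cover costs only a factor logarithmic in the number of points) give
  \<open>k \<le> q\<^sup>t O(t)\<close> for every \<open>q\<close> above the single-letter fractional covering numbers, and the
  factor \<open>O(t)\<close> disappears in the rate.
\<close>

section \<open>Powers of graphs\<close>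

text \<open>The factors vary with the position, as do the letter neighborhoods around a word and the
  coordinate projections of an independent set.\<close>

definition word_box :: "(nat \<Rightarrow> 'a set) \<Rightarrow> nat \<Rightarrow> 'a list set" where
  "word_box A t = {xs. length xs = t \<and> (\<forall>j<t. xs ! j \<in> A j)}"

lemma words_eq_word_box: "words X t = word_box (\<lambda>_. X) t"
  by (auto simp: words_def word_box_def set_conv_nth)

lemma word_box_Suc:
  "word_box A (Suc t) = (\<lambda>(x, xs). x # xs) ` (A 0 \<times> word_box (\<lambda>j. A (Suc j)) t)" (is "?L = ?R")
proof
  show "?L \<subseteq> ?R"
  proof
    fix xs assume xs: "xs \<in> ?L"
    then obtain y ys where "xs = y # ys"
      by (cases xs) (auto simp: word_box_def)
    with xs have "y \<in> A 0" "ys \<in> word_box (\<lambda>j. A (Suc j)) t"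
      by (fastforce simp: word_box_def)+
    with \<open>xs = y # ys\<close> show "xs \<in> ?R" by auto
  qed
  show "?R \<subseteq> ?L"
    by (auto simp: word_box_def nth_Cons split: nat.splits)
qed

text \<open>Distributivity: probabilities, cover weights and cardinalities of words all tensorize
  through this identity. Splitting off the first letter shifts \<open>A\<close> and
  \<open>f\<close>, so the induction generalizes both.\<close>

lemma sum_prod_word_box:
  fixes f :: "nat \<Rightarrow> 'a \<Rightarrow> 'b::comm_semiring_1"
  shows "(\<Sum>xs\<in>word_box A t. \<Prod>j<t. f j (xs ! j)) = (\<Prod>j<t. \<Sum>x\<in>A j. f j x)"
proof (induction t arbitrary: A f)
  case 0
  have "word_box A 0 = {[]}" by (auto simp: word_box_def)
  then show ?case by simp
next
  case (Suc t)
  let ?B = "word_box (\<lambda>j. A (Suc j)) t"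
  have "(\<Sum>xs\<in>word_box A (Suc t). \<Prod>j<Suc t. f j (xs ! j))
      = (\<Sum>(x, xs)\<in>A 0 \<times> ?B. f 0 x * (\<Prod>j<t. f (Suc j) (xs ! j)))"
    unfolding word_box_Suc
    by (subst sum.reindex) (auto simp: inj_on_def prod.lessThan_Suc_shift case_prod_beta simp del: prod.lessThan_Suc intro!: sum.cong)
  also have "\<dots> = (\<Sum>x\<in>A 0. f 0 x) * (\<Sum>xs\<in>?B. \<Prod>j<t. f (Suc j) (xs ! j))"
    by (simp add: sum_product sum.cartesian_product)
  also have "\<dots> = (\<Prod>j<Suc t. \<Sum>x\<in>A j. f j x)"
    by (simp add: Suc.IH[of "\<lambda>j. f (Suc j)" "\<lambda>j. A (Suc j)"] prod.lessThan_Suc_shift del: prod.lessThan_Suc)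
  finally show ?case .
qed

lemma finite_word_box: "(\<And>j. j < t \<Longrightarrow> finite (A j)) \<Longrightarrow> finite (word_box A t)"
proof (induction t arbitrary: A)
  case 0
  then show ?case by (simp add: word_box_def)
next
  case (Suc t)
  then show ?case unfolding word_box_Suc
    by (intro finite_imageI finite_cartesian_product Suc.IH) auto
qed

lemma card_word_box: "card (word_box A t) = (\<Prod>j<t. card (A j))"
  using sum_prod_word_box[where f = "\<lambda>_ _. 1::nat"] by simp

lemma finite_words: "finite X \<Longrightarrow> finite (words X t)"
  by (simp add: words_eq_word_box finite_word_box)

lemma card_words: "card (words X t) = card X ^ t"
  by (simp add: words_eq_word_box card_word_box)

lemma nth_words: "xs \<in> words X t \<Longrightarrow> j < t \<Longrightarrow> xs ! j \<in> X"
  by (simp add: words_eq_word_box word_box_def)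

lemma sum_word_prob_word_box:
  "(\<Sum>xs\<in>word_box A t. word_prob p xs) = (\<Prod>j<t. \<Sum>x\<in>A j. pmf p x)"
proof -
  have "(\<Sum>xs\<in>word_box A t. word_prob p xs) = (\<Sum>xs\<in>word_box A t. \<Prod>j<t. pmf p (xs ! j))"
    by (rule sum.cong) (auto simp: word_box_def word_prob_def)
  then show ?thesis by (simp only: sum_prod_word_box[where f = "\<lambda>_. pmf p"])
qed

lemma word_prob_nonneg: "0 \<le> word_prob p xs"
  by (simp add: word_prob_def prod_nonneg)

lemma sum_word_prob_words:
  assumes "finite X" "set_pmf p \<subseteq> X"
  shows "(\<Sum>xs\<in>words X t. word_prob p xs) = 1"
  using assms by (simp add: words_eq_word_box sum_word_prob_word_box sum_pmf_eq_1)

section \<open>Neighborhoods and independent sets in graph powers\<close>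

lemma vset_or_power [simp]: "vset (or_power G t) = words (vset G) t"
  by (simp add: or_power_def)

lemma vset_strong_power [simp]: "vset (strong_power G t) = words (vset G) t"
  by (simp add: strong_power_def)

lemma simple_graph_or_power: "simple_graph G \<Longrightarrow> simple_graph (or_power G t)"
  unfolding simple_graph_def
  by (auto simp: finite_words) (auto simp: or_power_def)

lemma closed_nbhd_subset: "closed_nbhd G x \<subseteq> vset G"
  by (auto simp: closed_nbhd_def)

lemma closed_nbhd_self: "x \<in> vset G \<Longrightarrow> x \<in> closed_nbhd G x"
  by (auto simp: closed_nbhd_def)

lemma closed_nbhd_set_subset: "closed_nbhd_set G K \<subseteq> vset G"
  using closed_nbhd_subset by (fastforce simp: closed_nbhd_set_def)

lemma closed_nbhd_strong_power:
  assumes "xs \<in> words (vset G) t"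
  shows "closed_nbhd (strong_power G t) xs = word_box (\<lambda>j. closed_nbhd G (xs ! j)) t"
  using assms unfolding closed_nbhd_def strong_power_def words_eq_word_box word_box_def
  by auto

lemma indep_set_or_power:
  assumes "\<And>j. j < t \<Longrightarrow> indep_set G (A j)"
  shows "indep_set (or_power G t) (word_box A t)"
  using assms unfolding indep_set_def or_power_def words_eq_word_box
  by (auto simp: word_box_def subset_iff)

text \<open>Adjacency in one coordinate already makes two words adjacent in the power, so every
  independent set there fits in a box of independent sets.\<close>

lemma indep_set_projection:
  assumes "indep_set (or_power G t) S" "j < t"
  shows "indep_set G ((\<lambda>xs. xs ! j) ` S)"
  using assms unfolding indep_set_def or_power_def
  by (auto simp: nth_words subset_iff)

lemma finite_max_indep_sets: "finite (vset G) \<Longrightarrow> finite (max_indep_sets G)"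
  by (rule finite_subset[of _ "Pow (vset G)"]) (auto simp: max_indep_sets_def indep_set_def)

lemma indep_set_extend:
  assumes "finite (vset G)" "indep_set G S"
  obtains T where "T \<in> max_indep_sets G" "S \<subseteq> T"
proof -
  have "finite {S. indep_set G S}"
    by (rule finite_subset[of _ "Pow (vset G)"]) (use assms in \<open>auto simp: indep_set_def\<close>)
  from finite_has_maximal2[OF this, of S] assms obtain T where
    "indep_set G T" "S \<subseteq> T" "\<And>S'. indep_set G S' \<Longrightarrow> T \<subseteq> S' \<Longrightarrow> T = S'"
    by auto
  then show ?thesis by (intro that[of T]) (auto simp: max_indep_sets_def)
qed

lemma indep_set_singleton: "simple_graph G \<Longrightarrow> x \<in> vset G \<Longrightarrow> indep_set G {x}"
  by (auto simp: indep_set_def simple_graph_def)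

lemma max_indep_sets_nonempty: "finite (vset G) \<Longrightarrow> max_indep_sets G \<noteq> {}"
  by (metis indep_set_extend indep_set_def empty_iff empty_subsetI)

lemma max_indep_set_nonempty:
  assumes "simple_graph G" "vset G \<noteq> {}" "T \<in> max_indep_sets G"
  shows "T \<noteq> {}"
  using assms indep_set_singleton[OF assms(1)] by (fastforce simp: max_indep_sets_def)

section \<open>Covering numbers\<close>

text \<open>Centers replace hyperedges. Distinct centers may have the same trace on
  \<open>T\<close>, and empty traces are no hyperedges, so the passage back can only lower the
  count.\<close>

lemma cover_num_le:
  assumes "finite C" "C \<subseteq> vset G" "T \<subseteq> closed_nbhd_set G C"
  shows "cover_num (assoc_hypergraph G T) \<le> card C"
proof -
  let ?F = "(\<lambda>x. T \<inter> closed_nbhd G x) ` C - {{}}"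
  have "?F \<subseteq> snd (assoc_hypergraph G T)"
    using assms by (auto simp: assoc_hypergraph_def)
  moreover have "\<Union>?F = fst (assoc_hypergraph G T)"
  proof -
    have "v \<in> \<Union>?F" if v: "v \<in> T" for v
    proof -
      obtain c where "c \<in> C" "v \<in> closed_nbhd G c"
        using assms(3) v by (auto simp: closed_nbhd_set_def)
      with v have "v \<in> T \<inter> closed_nbhd G c" "T \<inter> closed_nbhd G c \<in> ?F" by auto
      then show ?thesis by (rule UnionI[rotated])
    qed
    then show ?thesis by (auto simp: assoc_hypergraph_def)
  qed
  moreover have "finite ?F" using assms by auto
  ultimately have "cover_num (assoc_hypergraph G T) \<le> card ?F"
    unfolding cover_num_def by (intro Least_le) blast
  also have "card ?F \<le> card ((\<lambda>x. T \<inter> closed_nbhd G x) ` C)"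
    using assms by (intro card_mono) auto
  also have "\<dots> \<le> card C" by (rule card_image_le) fact
  finally show ?thesis .
qed

text \<open>The points of \<open>T\<close> are centers of a cover, so the minimum is attained. One
  center per hyperedge keeps the count, since a center determines its hyperedge.\<close>

lemma cover_num_attained:
  assumes "finite (vset G)" "T \<subseteq> vset G"
  obtains C where "C \<subseteq> vset G" "card C = cover_num (assoc_hypergraph G T)"
    "T \<subseteq> closed_nbhd_set G C"
proof -
  let ?H = "assoc_hypergraph G T"
  let ?P = "\<lambda>n. \<exists>F. F \<subseteq> snd ?H \<and> finite F \<and> card F = n \<and> \<Union>F = fst ?H"
  let ?F = "(\<lambda>x. T \<inter> closed_nbhd G x) ` T"
  have "?F \<subseteq> snd ?H" "\<Union>?F = fst ?H" "finite ?F"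
    using assms closed_nbhd_self[of _ G] by (auto simp: assoc_hypergraph_def finite_subset)
  then have "?P (card ?F)" by blast
  then have "?P (cover_num ?H)" unfolding cover_num_def by (rule LeastI)
  then obtain F where F: "F \<subseteq> snd ?H" "card F = cover_num ?H" "\<Union>F = T"
    by (auto simp: assoc_hypergraph_def)
  then have "\<forall>e\<in>F. \<exists>x\<in>vset G. e = T \<inter> closed_nbhd G x"
    by (auto simp: assoc_hypergraph_def)
  then obtain ctr where ctr: "\<And>e. e \<in> F \<Longrightarrow> ctr e \<in> vset G \<and> e = T \<inter> closed_nbhd G (ctr e)"
    by metis
  show ?thesis
  proof (rule that[of "ctr ` F"])
    have "inj_on ctr F" by (metis ctr inj_onI)
    then show "card (ctr ` F) = cover_num ?H" using F by (simp add: card_image)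
    show "ctr ` F \<subseteq> vset G" using ctr by auto
    show "T \<subseteq> closed_nbhd_set G (ctr ` F)"
      using F(3) ctr by (fastforce simp: closed_nbhd_set_def)
  qed
qed

lemma cover_num_le_card:
  assumes "finite (vset G)" "T \<subseteq> vset G"
  shows "cover_num (assoc_hypergraph G T) \<le> card (vset G)"
  by (metis assms card_mono cover_num_attained)

text \<open>Without a witness the least size in \<open>fold_cover_num\<close> would mean nothing.
  The neighborhoods of all points of \<open>T\<close> add at least one fold.\<close>

lemma fold_cover_exists:
  assumes "finite T" "T \<subseteq> vset G"
  shows "\<exists>M. set_mset M \<subseteq> snd (assoc_hypergraph G T) \<and> (\<forall>v\<in>T. b \<le> size {#e \<in># M. v \<in> e#})"
proof (induction b)
  case 0
  show ?case by (rule exI[of _ "{#}"]) simp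
next
  case (Suc b)
  then obtain M where M: "set_mset M \<subseteq> snd (assoc_hypergraph G T)"
    "\<forall>v\<in>T. b \<le> size {#e \<in># M. v \<in> e#}" by blast
  let ?L = "image_mset (\<lambda>v. T \<inter> closed_nbhd G v) (mset_set T)"
  have "set_mset (M + ?L) \<subseteq> snd (assoc_hypergraph G T)"
  proof -
    have "T \<inter> closed_nbhd G v \<in> snd (assoc_hypergraph G T)" if "v \<in> T" for v
    proof -
      have "v \<in> vset G" using assms(2) that by blast
      then have "v \<in> T \<inter> closed_nbhd G v" using that closed_nbhd_self[of v G] by simp
      with \<open>v \<in> vset G\<close> show ?thesis by (auto simp: assoc_hypergraph_def)
    qed
    then show ?thesis using M(1) assms(1) by auto
  qed
  moreover have "Suc b \<le> size {#e \<in># M + ?L. v \<in> e#}" if "v \<in> T" for v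
  proof -
    have "T \<inter> closed_nbhd G v \<in># {#e \<in># ?L. v \<in> e#}"
      using that assms closed_nbhd_self[of v G] by auto
    then have "1 \<le> size {#e \<in># ?L. v \<in> e#}"
      by (metis One_nat_def Suc_leI empty_not_add_mset gr0I insert_DiffM size_eq_0_iff_empty)
    moreover have "b \<le> size {#e \<in># M. v \<in> e#}" using M that by blast
    ultimately show ?thesis by simp
  qed
  ultimately show ?case by blast
qed

lemma fold_cover_num_attained:
  assumes "finite T" "T \<subseteq> vset G"
  obtains M where "size M = fold_cover_num (assoc_hypergraph G T) b"
    "set_mset M \<subseteq> snd (assoc_hypergraph G T)" "\<And>v. v \<in> T \<Longrightarrow> b \<le> size {#e \<in># M. v \<in> e#}"
proof -
  let ?P = "\<lambda>n. \<exists>M. size M = n \<and> set_mset M \<subseteq> snd (assoc_hypergraph G T) \<and>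
     (\<forall>v\<in>fst (assoc_hypergraph G T). b \<le> size {#e \<in># M. v \<in> e#})"
  from fold_cover_exists[OF assms, of b] obtain n where "?P n"
    by (auto simp: assoc_hypergraph_def)
  then have "?P (fold_cover_num (assoc_hypergraph G T) b)"
    unfolding fold_cover_num_def by (rule LeastI)
  then show ?thesis using that by (auto simp: assoc_hypergraph_def)
qed

text \<open>A single vertex of \<open>T\<close> already lies in \<open>b\<close> members of any
  \<open>b\<close>-fold cover.\<close>

lemma frac_cover_num_ge_1:
  assumes "finite T" "T \<subseteq> vset G" "T \<noteq> {}"
  shows "1 \<le> frac_cover_num (assoc_hypergraph G T)"
  unfolding frac_cover_num_def
proof (rule cINF_greatest)
  fix b :: nat assume b: "b \<in> {1..}"
  obtain M where M: "size M = fold_cover_num (assoc_hypergraph G T) b"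
    "\<And>v. v \<in> T \<Longrightarrow> b \<le> size {#e \<in># M. v \<in> e#}"
    by (rule fold_cover_num_attained[OF assms(1,2), of b]) blast
  from assms(3) obtain v where "v \<in> T" by blast
  then have "b \<le> size M" using M(2)[of v] size_filter_mset_lesseq[of "\<lambda>e. v \<in> e" M] by linarith
  then show "1 \<le> real (fold_cover_num (assoc_hypergraph G T) b) / real b"
    using M(1) b by simp
qed simp

lemma size_filter_mset_sum:
  assumes "finite X" "set_mset N \<subseteq> X"
  shows "(\<Sum>x\<in>{x\<in>X. P x}. count N x) = size {#x \<in># N. P x#}"
proof -
  have "size {#x \<in># N. P x#} = (\<Sum>x\<in>set_mset {#x \<in># N. P x#}. count {#x \<in># N. P x#} x)"
    by (simp add: size_multiset_overloaded_eq)
  also have "\<dots> = (\<Sum>x\<in>{x\<in>X. P x}. count {#x \<in># N. P x#} x)"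
    using assms by (intro sum.mono_neutral_left) (auto simp: not_in_iff)
  finally show ?thesis by simp
qed

text \<open>The slack below \<open>q\<close> gives a genuine \<open>b\<close>-fold cover even if the
  infimum is not attained; the multiplicities of its centers divided by \<open>b\<close> are
  feasible for the covering linear program.\<close>

lemma frac_cover_weights:
  assumes "finite (vset G)" "T \<subseteq> vset G" "frac_cover_num (assoc_hypergraph G T) < q"
  obtains \<mu> :: "'a \<Rightarrow> real" where "\<And>x. 0 \<le> \<mu> x" "sum \<mu> (vset G) \<le> q"
    "\<And>v. v \<in> T \<Longrightarrow> 1 \<le> (\<Sum>x\<in>{x\<in>vset G. v \<in> closed_nbhd G x}. \<mu> x)"
proof -
  let ?H = "assoc_hypergraph G T"
  have fin: "finite T" using assms finite_subset by blast
  have "\<exists>b\<in>{1..}. real (fold_cover_num ?H b) / real b < q"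
    using assms(3) unfolding frac_cover_num_def
    by (subst (asm) cINF_less_iff) (auto intro!: bdd_belowI[of _ 0])
  then obtain b where b: "b \<ge> 1" "real (fold_cover_num ?H b) / real b < q" by auto
  obtain M where M: "size M = fold_cover_num ?H b"
    "set_mset M \<subseteq> snd ?H" "\<And>v. v \<in> T \<Longrightarrow> b \<le> size {#e \<in># M. v \<in> e#}"
    using fold_cover_num_attained[OF fin assms(2), of b] by metis
  have "\<forall>e\<in>snd ?H. \<exists>x\<in>vset G. e = T \<inter> closed_nbhd G x"
    by (auto simp: assoc_hypergraph_def)
  then obtain ctr where ctr: "\<And>e. e \<in> snd ?H \<Longrightarrow> ctr e \<in> vset G \<and> e = T \<inter> closed_nbhd G (ctr e)"
    by metis
  define N where "N = image_mset ctr M"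
  have N: "set_mset N \<subseteq> vset G" using ctr M(2) by (auto simp: N_def)
  define \<mu> where "\<mu> x = real (count N x) / real b" for x
  show ?thesis
  proof (rule that[of \<mu>])
    show "0 \<le> \<mu> x" for x by (simp add: \<mu>_def)
    have "(\<Sum>x\<in>vset G. count N x) = size M"
      using size_filter_mset_sum[OF assms(1) N, of "\<lambda>_. True"] by (simp add: N_def)
    then have "sum \<mu> (vset G) = real (size M) / real b"
      unfolding \<mu>_def by (metis of_nat_sum sum_divide_distrib)
    then show "sum \<mu> (vset G) \<le> q" using b M by simp
  next
    fix v assume v: "v \<in> T"
    have "b \<le> size {#e \<in># M. v \<in> e#}" by (rule M(3)[OF v])
    also have "\<dots> \<le> size {#e \<in># M. v \<in> closed_nbhd G (ctr e)#}"
      by (intro size_mset_mono filter_mset_mono_strong) (use ctr M(2) in auto)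
    also have "\<dots> = size {#x \<in># N. v \<in> closed_nbhd G x#}"
      by (simp add: N_def filter_mset_image_mset)
    also have "\<dots> = (\<Sum>x\<in>{x\<in>vset G. v \<in> closed_nbhd G x}. count N x)"
      by (rule size_filter_mset_sum[OF assms(1) N, symmetric])
    finally have "real b \<le> (\<Sum>x\<in>{x\<in>vset G. v \<in> closed_nbhd G x}. real (count N x))"
      by (metis of_nat_mono of_nat_sum)
    then show "1 \<le> (\<Sum>x\<in>{x\<in>vset G. v \<in> closed_nbhd G x}. \<mu> x)"
      using b(1) by (simp add: \<mu>_def sum_divide_distrib[symmetric])
  qed
qed

section \<open>From fractional to integral covers\<close>

text \<open>By averaging over \<open>\<mu>\<close>, some set contains at least a
  \<open>1 / Q\<close> fraction of the uncovered points, so each greedy choice leaves at most a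
  \<open>1 - 1 / Q\<close> fraction of them.\<close>

lemma greedy_cover:
  fixes \<mu> :: "'a \<Rightarrow> real" and N :: "'a \<Rightarrow> 'b set"
  assumes "finite V" "finite U" "\<And>x. x \<in> V \<Longrightarrow> 0 \<le> \<mu> x" "sum \<mu> V \<le> Q" "1 \<le> Q"
    and cov: "\<And>u. u \<in> U \<Longrightarrow> 1 \<le> (\<Sum>x\<in>{x\<in>V. u \<in> N x}. \<mu> x)"
  shows "\<exists>C\<subseteq>V. card C \<le> n \<and> real (card (U - \<Union>(N ` C))) \<le> (1 - 1 / Q) ^ n * real (card U)"
proof (induction n)
  case 0
  show ?case by (rule exI[of _ "{}"]) simp
next
  case (Suc n)
  then obtain C where C: "C \<subseteq> V" "card C \<le> n"
    "real (card (U - \<Union>(N ` C))) \<le> (1 - 1 / Q) ^ n * real (card U)" by blast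
  define R where "R = U - \<Union>(N ` C)"
  have nonneg: "0 \<le> 1 - 1 / Q" using assms(5) by simp
  show ?case
  proof (cases "R = {}")
    \<comment> \<open>With nothing left to cover, \<open>V\<close> may even be empty, so
      \<open>C\<close> is kept as it is.\<close>
    case True
    have "0 \<le> (1 - 1 / Q) ^ Suc n * real (card U)"
      using nonneg by (intro mult_nonneg_nonneg zero_le_power) auto
    moreover have "real (card (U - \<Union>(N ` C))) = 0" using True by (simp only: R_def) simp
    ultimately show ?thesis using C(1,2) by (intro exI[of _ C]) linarith
  next
    case False
    have finR: "finite R" using assms(2) by (simp add: R_def)
    obtain u where "u \<in> R" using False by blast
    then have "V \<noteq> {}" using cov[of u] by (auto simp: R_def)
    define m where "m = Max ((\<lambda>x. card (R \<inter> N x)) ` V)"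
    have "m \<in> (\<lambda>x. card (R \<inter> N x)) ` V"
      unfolding m_def using assms(1) \<open>V \<noteq> {}\<close> by (intro Max_in) auto
    then obtain x where x: "x \<in> V" "m = card (R \<inter> N x)" by auto
    have le_m: "card (R \<inter> N y) \<le> m" if "y \<in> V" for y
      unfolding m_def using assms(1) that by (intro Max_ge) auto
    \<comment> \<open>Double counting: every uncovered point meets weight at least 1, while no
      single set contains more than \<open>m\<close> uncovered points.\<close>
    have "real (card R) = (\<Sum>u\<in>R. 1)" by simp
    also have "\<dots> \<le> (\<Sum>u\<in>R. \<Sum>x\<in>{x\<in>V. u \<in> N x}. \<mu> x)"
      by (intro sum_mono cov) (auto simp: R_def)
    also have "\<dots> = (\<Sum>x\<in>V. \<Sum>u\<in>{u\<in>R. u \<in> N x}. \<mu> x)"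
      by (rule sum.swap_restrict[OF finR assms(1)])
    also have "\<dots> = (\<Sum>x\<in>V. real (card (R \<inter> N x)) * \<mu> x)"
      by (simp add: Int_def)
    also have "\<dots> \<le> (\<Sum>x\<in>V. real m * \<mu> x)"
      by (intro sum_mono mult_right_mono) (use le_m assms(3) in auto)
    also have "\<dots> \<le> real m * Q"
      using assms(4) by (simp add: sum_distrib_left[symmetric] mult_left_mono)
    finally have m: "real (card R) / Q \<le> real m" using assms(5) by (simp add: field_simps)
    have "card (R - N x) = card R - m"
      using finR by (simp add: card_Diff_subset_Int x(2))
    moreover have "m \<le> card R" unfolding x(2) using finR by (intro card_mono) auto
    ultimately have "real (card (R - N x)) = real (card R) - real m" by simp
    also have "\<dots> \<le> (1 - 1 / Q) * real (card R)" using m by (simp add: algebra_simps)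
    also have "\<dots> \<le> (1 - 1 / Q) * ((1 - 1 / Q) ^ n * real (card U))"
      using C(3) nonneg unfolding R_def by (rule mult_left_mono)
    finally have "real (card (R - N x)) \<le> (1 - 1 / Q) ^ Suc n * real (card U)" by simp
    moreover have "U - \<Union>(N ` insert x C) = R - N x" by (auto simp: R_def)
    moreover have "card (insert x C) \<le> Suc n"
      using C(2) card_insert_le_m1[of "Suc n" C x] by simp
    ultimately show ?thesis using C(1) x(1) by (intro exI[of _ "insert x C"]) simp
  qed
qed

text \<open>Since \<open>1 - 1 / Q \<le> exp (- (1 / Q))\<close>, slightly more than
  \<open>Q * ln (card U)\<close> greedy rounds leave fewer than one point uncovered, hence
  none.\<close>

lemma integral_cover_from_weights:
  fixes \<mu> :: "'a \<Rightarrow> real" and N :: "'a \<Rightarrow> 'b set"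
  assumes "finite V" "finite U" "\<And>x. x \<in> V \<Longrightarrow> 0 \<le> \<mu> x" "sum \<mu> V \<le> Q" "1 \<le> Q"
    and "\<And>u. u \<in> U \<Longrightarrow> 1 \<le> (\<Sum>x\<in>{x\<in>V. u \<in> N x}. \<mu> x)"
  obtains C where "C \<subseteq> V" "U \<subseteq> \<Union>(N ` C)" "real (card C) \<le> Q * ln (real (card U)) + 2"
proof (cases "U = {}")
  case True
  then show ?thesis using that[of "{}"] by simp
next
  case False
  then have pos: "card U \<ge> 1" using assms(2) by (simp add: Suc_leI card_gt_0_iff)
  define L where "L = Q * ln (real (card U))"
  have "0 \<le> L" using pos assms(5) by (simp add: L_def)
  \<comment> \<open>The added 1 puts \<open>n\<close> strictly above \<open>L\<close> even when
    \<open>L\<close> is an integer, so that the remainder is strictly below 1.\<close>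
  define n where "n = nat \<lceil>L\<rceil> + 1"
  have n: "L < real n" "real n \<le> L + 2"
    using \<open>0 \<le> L\<close> unfolding n_def by linarith+
  obtain C where C: "C \<subseteq> V" "card C \<le> n"
    "real (card (U - \<Union>(N ` C))) \<le> (1 - 1 / Q) ^ n * real (card U)"
    using greedy_cover[OF assms, of n] by blast
  have "(1 - 1 / Q) ^ n \<le> exp (- (1 / Q)) ^ n"
    by (rule power_mono) (use exp_ge_add_one_self[of "- (1 / Q)"] assms(5) in auto)
  also have "\<dots> = exp (- (real n / Q))"
    by (simp add: exp_of_nat_mult[symmetric])
  also have "\<dots> < exp (- ln (real (card U)))"
    using n(1) assms(5) by (simp add: L_def field_simps)
  also have "\<dots> = 1 / real (card U)" using pos by (simp add: exp_minus inverse_eq_divide)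
  finally have "(1 - 1 / Q) ^ n * real (card U) < 1" using pos by (simp add: field_simps)
  with C(3) have "card (U - \<Union>(N ` C)) = 0" by linarith
  then have "U \<subseteq> \<Union>(N ` C)" using assms(2) by auto
  moreover have "real (card C) \<le> L + 2" using C(2) n(2) by linarith
  ultimately show ?thesis using that C(1) by (simp add: L_def)
qed

text \<open>Single-letter cover weights multiply to weights of total at most \<open>q ^ t\<close> on
  words. Making the cover integral then costs only a factor linear in \<open>t\<close>, because
  \<open>T\<close> has at most \<open>card (vset \<Theta>) ^ t\<close> points.\<close>

lemma cover_num_or_power_le:
  assumes "simple_graph \<Gamma>" "simple_graph \<Theta>" "vset \<Gamma> = vset \<Theta>" "vset \<Theta> \<noteq> {}" "1 \<le> q"
    and q: "\<And>T. T \<in> max_indep_sets \<Gamma> \<Longrightarrow> frac_cover_num (assoc_hypergraph \<Theta> T) < q"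
    and "T \<in> max_indep_sets (or_power \<Gamma> t)"
  shows "real (cover_num (assoc_hypergraph (strong_power \<Theta> t) T))
    \<le> q ^ t * (real t * ln (real (card (vset \<Theta>))) + 2)"
proof -
  let ?X = "vset \<Theta>"
  have finX: "finite ?X" using assms(2) by (simp add: simple_graph_def)
  have T: "indep_set (or_power \<Gamma> t) T" "T \<subseteq> words ?X t"
    using assms(3,7) by (auto simp: max_indep_sets_def indep_set_def)
  have "\<exists>A. A \<in> max_indep_sets \<Gamma> \<and> (\<lambda>xs. xs ! j) ` T \<subseteq> A" if "j < t" for j
    using indep_set_extend[OF _ indep_set_projection[OF T(1) that]] finX assms(3) by metis
  then obtain A where A: "\<And>j. j < t \<Longrightarrow> A j \<in> max_indep_sets \<Gamma>"
    "\<And>j. j < t \<Longrightarrow> (\<lambda>xs. xs ! j) ` T \<subseteq> A j" by metis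
  have "\<exists>\<mu> :: 'a \<Rightarrow> real. (\<forall>x. 0 \<le> \<mu> x) \<and> sum \<mu> ?X \<le> q \<and>
      (\<forall>v\<in>A j. 1 \<le> (\<Sum>x\<in>{x\<in>?X. v \<in> closed_nbhd \<Theta> x}. \<mu> x))" if "j < t" for j
  proof -
    have "A j \<subseteq> ?X" using A(1)[OF that] assms(3) by (auto simp: max_indep_sets_def indep_set_def)
    then show ?thesis
      by (rule frac_cover_weights[OF finX _ q[OF A(1)[OF that]]]) blast
  qed
  then have "\<forall>j. \<exists>\<mu> :: 'a \<Rightarrow> real. j < t \<longrightarrow> (\<forall>x. 0 \<le> \<mu> x) \<and> sum \<mu> ?X \<le> q \<and>
      (\<forall>v\<in>A j. 1 \<le> (\<Sum>x\<in>{x\<in>?X. v \<in> closed_nbhd \<Theta> x}. \<mu> x))" by blast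
  from choice[OF this] obtain \<mu> :: "nat \<Rightarrow> 'a \<Rightarrow> real" where \<mu>: "\<And>j x. j < t \<Longrightarrow> 0 \<le> \<mu> j x"
    "\<And>j. j < t \<Longrightarrow> sum (\<mu> j) ?X \<le> q"
    "\<And>j v. j < t \<Longrightarrow> v \<in> A j \<Longrightarrow> 1 \<le> (\<Sum>x\<in>{x\<in>?X. v \<in> closed_nbhd \<Theta> x}. \<mu> j x)"
    by blast
  define M where "M xs = (\<Prod>j<t. \<mu> j (xs ! j))" for xs
  let ?N = "closed_nbhd (strong_power \<Theta> t)"
  have finT: "finite T" using T(2) finite_words[OF finX] finite_subset by blast
  have M_nonneg: "0 \<le> M xs" for xs unfolding M_def using \<mu>(1) by (intro prod_nonneg) auto
  have M_sum: "sum M (words ?X t) \<le> q ^ t"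
  proof -
    have "sum M (words ?X t) = (\<Prod>j<t. sum (\<mu> j) ?X)"
      unfolding M_def words_eq_word_box by (rule sum_prod_word_box)
    also have "\<dots> \<le> (\<Prod>j<t. q)"
      using \<mu>(1,2) by (intro prod_mono) (auto intro: sum_nonneg)
    finally show ?thesis by simp
  qed
  \<comment> \<open>The centers whose neighborhoods contain \<open>v\<close> form a box, so their
    total weight is a product of single-letter sums, each at least 1.\<close>
  have M_cov: "1 \<le> (\<Sum>xs\<in>{xs\<in>words ?X t. v \<in> ?N xs}. M xs)" if v: "v \<in> T" for v
  proof -
    have vw: "v \<in> words ?X t" using T(2) v by blast
    have "{xs\<in>words ?X t. v \<in> ?N xs} = word_box (\<lambda>j. {x\<in>?X. v ! j \<in> closed_nbhd \<Theta> x}) t"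
    proof -
      have "v \<in> ?N xs \<longleftrightarrow> (\<forall>j<t. v ! j \<in> closed_nbhd \<Theta> (xs ! j))" if "xs \<in> words ?X t" for xs
        using vw by (simp add: closed_nbhd_strong_power[OF that] words_eq_word_box word_box_def)
      then have "{xs\<in>words ?X t. v \<in> ?N xs}
          = {xs\<in>words ?X t. \<forall>j<t. v ! j \<in> closed_nbhd \<Theta> (xs ! j)}" by blast
      then show ?thesis by (auto simp: words_eq_word_box word_box_def)
    qed
    then have "(\<Sum>xs\<in>{xs\<in>words ?X t. v \<in> ?N xs}. M xs)
        = (\<Prod>j<t. \<Sum>x\<in>{x\<in>?X. v ! j \<in> closed_nbhd \<Theta> x}. \<mu> j x)"
      unfolding M_def by (simp only: sum_prod_word_box)
    also have "1 \<le> \<dots>"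
    proof (rule prod_ge_1)
      fix j assume "j \<in> {..<t}"
      then have "j < t" by simp
      moreover from this have "v ! j \<in> A j" using A(2)[of j] v by blast
      ultimately show "1 \<le> (\<Sum>x\<in>{x\<in>?X. v ! j \<in> closed_nbhd \<Theta> x}. \<mu> j x)"
        by (rule \<mu>(3))
    qed
    finally show ?thesis .
  qed
  obtain C where C: "C \<subseteq> words ?X t" "T \<subseteq> \<Union>(?N ` C)"
    "real (card C) \<le> q ^ t * ln (real (card T)) + 2"
    by (rule integral_cover_from_weights[OF finite_words[OF finX] finT M_nonneg M_sum _ M_cov])
      (use assms(5) in auto)
  have "cover_num (assoc_hypergraph (strong_power \<Theta> t) T) \<le> card C"
    using C finite_words[OF finX] by (intro cover_num_le) (auto simp: closed_nbhd_set_def finite_subset)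
  then have "real (cover_num (assoc_hypergraph (strong_power \<Theta> t) T)) \<le> real (card C)" by simp
  also note C(3)
  \<comment> \<open>The additive 2 is absorbed into \<open>q ^ t * 2\<close> by
    \<open>1 \<le> q\<close>.\<close>
  also have "q ^ t * ln (real (card T)) + 2 \<le> q ^ t * (real t * ln (real (card ?X))) + q ^ t * 2"
  proof (rule add_mono)
    have "card ?X \<ge> 1" using finX assms(4) by (simp add: Suc_leI card_gt_0_iff)
    have "T \<noteq> {}"
    proof (rule max_indep_set_nonempty[OF simple_graph_or_power[OF assms(1)] _ assms(7)])
      have "card (words ?X t) > 0" using \<open>card ?X \<ge> 1\<close> by (simp add: card_words)
      then show "vset (or_power \<Gamma> t) \<noteq> {}" using assms(3) by auto
    qed
    then have "card T \<ge> 1" using finT by (simp add: Suc_leI card_gt_0_iff)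
    moreover have "card T \<le> card ?X ^ t"
      using card_mono[OF finite_words[OF finX] T(2)] by (simp add: card_words)
    ultimately have "ln (real (card T)) \<le> ln (real (card ?X) ^ t)"
      by (metis ln_mono of_nat_0_less_iff of_nat_mono of_nat_power less_le_trans zero_less_one)
    also have "\<dots> = real t * ln (real (card ?X))"
      using \<open>card ?X \<ge> 1\<close> by (simp add: ln_realpow)
    finally show "q ^ t * ln (real (card T)) \<le> q ^ t * (real t * ln (real (card ?X)))"
      using assms(5) by (intro mult_left_mono) auto
    show "2 \<le> q ^ t * 2" using assms(5) by simp
  qed
  finally show ?thesis by (simp add: algebra_simps)
qed

section \<open>Keeping the heaviest guesses\<close>

text \<open>The \<open>g\<close> heaviest members have at least the overall average weight;
  cross-multiplication avoids dividing by a cardinality. The induction removes a lightest element,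
  which does not lower the average of the rest.\<close>

lemma heavy_subset:
  fixes w :: "'a \<Rightarrow> real"
  assumes "finite F" "g \<le> card F"
  shows "\<exists>G\<subseteq>F. card G = g \<and> real g * sum w F \<le> real (card F) * sum w G"
  using assms
proof (induction "card F" arbitrary: F)
  case 0
  then show ?case by auto
next
  case (Suc k)
  show ?case
  proof (cases "g = Suc k")
    case True
    then show ?thesis using Suc by (intro exI[of _ F]) auto
  next
    case False
    then have g: "g \<le> k" using Suc by linarith
    have "F \<noteq> {}" using Suc by auto
    then obtain e where e: "e \<in> F" "\<And>x. x \<in> F \<Longrightarrow> w e \<le> w x"
      using arg_min_if_finite(1)[of F w] arg_min_least[of F _ w] Suc.prems(1) by blast
    have card: "k = card (F - {e})" using e(1) Suc by simp
    obtain G where G: "G \<subseteq> F - {e}" "card G = g"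
      "real g * sum w (F - {e}) \<le> real k * sum w G"
      using Suc.hyps(1)[OF card] Suc.prems g card by auto
    have "real (Suc k) * w e \<le> sum w F"
      using sum_bounded_below[of F "w e" w] e(2) Suc.hyps(2) by simp
    moreover have "sum w F = w e + sum w (F - {e})"
      using Suc.prems(1) e(1) by (rule sum.remove)
    ultimately have *: "real k * sum w F \<le> real (Suc k) * sum w (F - {e})"
      by (simp add: algebra_simps)
    \<comment> \<open>The two inequalities combine only after multiplication by \<open>k\<close>, so
      \<open>k = 0\<close> is treated separately.\<close>
    have "real g * sum w F \<le> real (Suc k) * sum w G"
    proof (cases "k = 0")
      case True
      then have "F - {e} = {}" using card Suc.prems(1) by (metis card_0_eq finite_Diff)
      then have "g = 0" "G = {}" using g G(1) True by auto
      then show ?thesis by simp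
    next
      case False
      have "real k * (real g * sum w F) \<le> real g * (real (Suc k) * sum w (F - {e}))"
        using mult_left_mono[OF *, of "real g"] by (simp add: ac_simps)
      also have "\<dots> \<le> real (Suc k) * (real k * sum w G)"
        using mult_left_mono[OF G(3), of "real (Suc k)"] by (simp add: ac_simps)
      also have "\<dots> = real k * (real (Suc k) * sum w G)" by simp
      finally show ?thesis using False by simp
    qed
    then show ?thesis using G Suc.hyps(2) by (intro exI[of _ G]) auto
  qed
qed

text \<open>Neighborhoods overlap, so each point \<open>v\<close> of \<open>T\<close> is charged to
  one center \<open>a v\<close>. The classes partition \<open>T\<close>, and each lies in the
  neighborhood of its center, where further points only add nonnegative weight.\<close>

lemma heavy_subcover:
  fixes f :: "'a \<Rightarrow> real"
  assumes "finite (vset G)" "C \<subseteq> vset G" "T \<subseteq> closed_nbhd_set G C" "g \<le> card C"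
    and "\<And>x. x \<in> vset G \<Longrightarrow> 0 \<le> f x"
  shows "\<exists>K\<subseteq>vset G. card K = g \<and> real g * sum f T \<le> real (card C) * sum f (closed_nbhd_set G K)"
proof -
  have fin: "finite C" "finite T"
    using assms(1-3) closed_nbhd_set_subset[of G C] by (auto intro: finite_subset)
  have "\<forall>v\<in>T. \<exists>c\<in>C. v \<in> closed_nbhd G c"
    using assms(3) by (auto simp: closed_nbhd_set_def)
  then obtain a where a: "\<And>v. v \<in> T \<Longrightarrow> a v \<in> C \<and> v \<in> closed_nbhd G (a v)" by metis
  define w where "w c = sum f {v\<in>T. a v = c}" for c
  obtain K where K: "K \<subseteq> C" "card K = g" "real g * sum w C \<le> real (card C) * sum w K"
    using heavy_subset[OF fin(1) assms(4), of w] by blast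
  have "sum w C = sum f T"
    unfolding w_def using a by (intro sum.group fin) auto
  moreover have "sum w K \<le> sum f (closed_nbhd_set G K)"
  proof -
    have "sum w K = (\<Sum>c\<in>K. sum f {v\<in>{v\<in>T. a v \<in> K}. a v = c})"
      unfolding w_def by (intro sum.cong refl arg_cong[where f = "sum f"]) auto
    also have "\<dots> = sum f {v\<in>T. a v \<in> K}"
      using fin K(1) by (intro sum.group) (auto intro: finite_subset)
    also have "\<dots> \<le> sum f (closed_nbhd_set G K)"
    proof (rule sum_mono2)
      show "finite (closed_nbhd_set G K)"
        using closed_nbhd_set_subset assms(1) by (rule finite_subset)
      show "{v\<in>T. a v \<in> K} \<subseteq> closed_nbhd_set G K"
        using a by (auto simp: closed_nbhd_set_def)
      show "0 \<le> f b" if "b \<in> closed_nbhd_set G K - {v\<in>T. a v \<in> K}" for b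
        using that closed_nbhd_set_subset[of G K] assms(5) by blast
    qed
    finally show ?thesis .
  qed
  ultimately have "real g * sum f T \<le> real (card C) * sum f (closed_nbhd_set G K)"
    using K(3) by (smt (verit) mult_left_mono of_nat_0_le_iff)
  then show ?thesis using K assms(2) by blast
qed

lemma sum_UN_le:
  fixes f :: "'a \<Rightarrow> real"
  assumes "finite K" "\<And>x. x \<in> K \<Longrightarrow> finite (A x)" "\<And>x. 0 \<le> f x"
  shows "sum f (\<Union>x\<in>K. A x) \<le> (\<Sum>x\<in>K. sum f (A x))"
  using assms(1,2)
proof (induction K rule: finite_induct)
  case (insert x K)
  then have "sum f (\<Union>x\<in>insert x K. A x)
      = sum f (A x) + sum f (\<Union>x\<in>K. A x) - sum f (A x \<inter> (\<Union>x\<in>K. A x))"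
    by (simp add: sum_Un)
  also have "\<dots> \<le> sum f (A x) + sum f (\<Union>x\<in>K. A x)"
    using assms(3) by (simp add: sum_nonneg)
  also have "\<dots> \<le> (\<Sum>x\<in>insert x K. sum f (A x))" using insert by simp
  finally show ?case .
qed simp

section \<open>Leakage\<close>

locale guessing_setup =
  fixes \<Gamma> \<Theta> :: "'a sgraph" and X :: "'a set" and g :: "nat \<Rightarrow> nat" and c :: real
  assumes graph_\<Gamma>: "simple_graph \<Gamma>" and graph_\<Theta>: "simple_graph \<Theta>"
    and vset_\<Gamma>: "vset \<Gamma> = X" and vset_\<Theta>: "vset \<Theta> = X" and X_nonempty: "X \<noteq> {}"
    and guessing: "guessing_capability \<Gamma> \<Theta> g"
    and c_gt_1: "c > 1"
begin

section \<open>Optimal guesses and the leakage ratio\<close>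

definition max_cover :: "nat \<Rightarrow> nat" where
  "max_cover t = Max ((\<lambda>T. cover_num (assoc_hypergraph (strong_power \<Theta> t) T))
                        ` max_indep_sets (or_power \<Gamma> t))"

text \<open>The weight \<open>f\<close> is arbitrary because the denominator of the leakage ratio
  and each summand of its numerator have this shape.\<close>

definition max_guess :: "nat \<Rightarrow> ('a list \<Rightarrow> real) \<Rightarrow> real" where
  "max_guess t f = Max ((\<lambda>K. sum f (closed_nbhd_set (strong_power \<Theta> t) K))
                          ` guess_sets \<Theta> t (g t))"

definition leakage_ratio :: "nat \<Rightarrow> nat set \<Rightarrow> ('a list \<Rightarrow> nat pmf) \<Rightarrow> 'a pmf \<Rightarrow> real" where
  "leakage_ratio t Y W p =
     (\<Sum>y\<in>Y. max_guess t (\<lambda>xs. word_prob p xs * pmf (W xs) y)) / max_guess t (word_prob p)"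

lemma leakage_eq:
  "leakage c \<Theta> g t Y W = log c (SUP p\<in>{p. set_pmf p \<subseteq> X}. leakage_ratio t Y W p)"
  by (simp add: leakage_def leakage_ratio_def max_guess_def vset_\<Theta>)

lemma finite_X: "finite X"
  using graph_\<Theta> vset_\<Theta> by (auto simp: simple_graph_def)

lemma finite_V: "finite (words X t)"
  by (rule finite_words[OF finite_X])

lemma max_indep_or_power:
  "finite (max_indep_sets (or_power \<Gamma> t))" "max_indep_sets (or_power \<Gamma> t) \<noteq> {}"
  "T \<in> max_indep_sets (or_power \<Gamma> t) \<Longrightarrow> T \<subseteq> words X t"
proof -
  have fin: "finite (vset (or_power \<Gamma> t))" by (simp add: vset_\<Gamma> finite_V)
  show "finite (max_indep_sets (or_power \<Gamma> t))" by (rule finite_max_indep_sets[OF fin])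
  show "max_indep_sets (or_power \<Gamma> t) \<noteq> {}" by (rule max_indep_sets_nonempty[OF fin])
  show "T \<subseteq> words X t" if "T \<in> max_indep_sets (or_power \<Gamma> t)"
    using that by (simp add: max_indep_sets_def indep_set_def vset_\<Gamma>)
qed

lemma max_cover_attained:
  obtains T where "T \<in> max_indep_sets (or_power \<Gamma> t)"
    "max_cover t = cover_num (assoc_hypergraph (strong_power \<Theta> t) T)"
proof -
  have "max_cover t \<in> (\<lambda>T. cover_num (assoc_hypergraph (strong_power \<Theta> t) T))
      ` max_indep_sets (or_power \<Gamma> t)"
    unfolding max_cover_def using max_indep_or_power by (intro Max_in) auto
  then show ?thesis using that by auto
qed

text \<open>Together with \<open>g t \<le> max_cover t\<close> this ensures that sets of
  \<open>g t\<close> words exist, so the maximum in \<open>max_guess\<close> is over a nonempty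
  family.\<close>

lemma max_cover_le_card: "max_cover t \<le> card (words X t)"
proof -
  obtain T where T: "T \<in> max_indep_sets (or_power \<Gamma> t)"
    "max_cover t = cover_num (assoc_hypergraph (strong_power \<Theta> t) T)"
    by (rule max_cover_attained)
  have "T \<subseteq> words X t" using T(1) by (rule max_indep_or_power(3))
  then show ?thesis
    using cover_num_le_card[of "strong_power \<Theta> t" T] finite_V by (simp add: T(2) vset_\<Theta>)
qed

lemma g_bounds:
  assumes "t \<ge> 1"
  shows "1 \<le> g t" "g t \<le> max_cover t"
  using guessing assms by (auto simp: guessing_capability_def max_cover_def)

lemma finite_guess_sets: "finite (guess_sets \<Theta> t n)"
  by (rule finite_subset[of _ "Pow (words X t)"]) (auto simp: guess_sets_def vset_\<Theta> finite_V)

lemma guess_le_max_guess: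
  "K \<subseteq> words X t \<Longrightarrow> card K = g t \<Longrightarrow>
    sum f (closed_nbhd_set (strong_power \<Theta> t) K) \<le> max_guess t f"
  unfolding max_guess_def
  by (intro Max_ge finite_imageI finite_guess_sets) (auto simp: guess_sets_def vset_\<Theta>)

lemma max_guess_attained:
  assumes "t \<ge> 1"
  obtains K where "K \<subseteq> words X t" "card K = g t"
    "max_guess t f = sum f (closed_nbhd_set (strong_power \<Theta> t) K)"
proof -
  have "g t \<le> card (words X t)"
    using g_bounds[OF assms] max_cover_le_card[of t] by simp
  then obtain K where "K \<subseteq> words X t" "card K = g t"
    using obtain_subset_with_card_n by metis
  then have "guess_sets \<Theta> t (g t) \<noteq> {}" by (auto simp: guess_sets_def vset_\<Theta>)
  then have "max_guess t f \<in> (\<lambda>K. sum f (closed_nbhd_set (strong_power \<Theta> t) K))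
      ` guess_sets \<Theta> t (g t)"
    unfolding max_guess_def by (intro Max_in finite_imageI finite_guess_sets) auto
  then show ?thesis using that by (auto simp: guess_sets_def vset_\<Theta>)
qed

lemma guess_set_subset: "closed_nbhd_set (strong_power \<Theta> t) K \<subseteq> words X t"
  using closed_nbhd_set_subset[of "strong_power \<Theta> t" K] by (simp add: vset_\<Theta>)

lemma max_guess_ge_cover:
  assumes "t \<ge> 1" "C \<subseteq> words X t" "S \<subseteq> closed_nbhd_set (strong_power \<Theta> t) C" "g t \<le> card C"
    and "\<And>xs. xs \<in> words X t \<Longrightarrow> 0 \<le> f xs"
  shows "real (g t) * sum f S \<le> real (card C) * max_guess t f"
proof -
  have "\<exists>K\<subseteq>vset (strong_power \<Theta> t). card K = g t \<and>
      real (g t) * sum f S \<le> real (card C) * sum f (closed_nbhd_set (strong_power \<Theta> t) K)"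
    by (rule heavy_subcover) (use assms finite_V in \<open>auto simp: vset_\<Theta>\<close>)
  then obtain K where K: "K \<subseteq> words X t" "card K = g t"
    "real (g t) * sum f S \<le> real (card C) * sum f (closed_nbhd_set (strong_power \<Theta> t) K)"
    by (auto simp: vset_\<Theta>)
  note K(3)
  also have "real (card C) * sum f (closed_nbhd_set (strong_power \<Theta> t) K)
      \<le> real (card C) * max_guess t f"
    by (intro mult_left_mono guess_le_max_guess K) auto
  finally show ?thesis .
qed

text \<open>Meant for the support of a code symbol. A cover of a maximal independent set around
  \<open>S\<close>, cut down to its \<open>g t\<close> heaviest members, captures at least the
  fraction \<open>g t / max_cover t\<close> of the weight of \<open>S\<close>.\<close>

lemma max_guess_ge_indep:
  assumes "t \<ge> 1" "indep_set (or_power \<Gamma> t) S" "\<And>xs. xs \<in> words X t \<Longrightarrow> 0 \<le> f xs"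
  shows "real (g t) * sum f S \<le> real (max_cover t) * max_guess t f"
proof -
  obtain T where T: "T \<in> max_indep_sets (or_power \<Gamma> t)" "S \<subseteq> T"
    by (rule indep_set_extend[OF _ assms(2)]) (simp_all add: finite_V vset_\<Gamma>)
  obtain C where C: "C \<subseteq> words X t" "T \<subseteq> closed_nbhd_set (strong_power \<Theta> t) C"
    "card C = cover_num (assoc_hypergraph (strong_power \<Theta> t) T)"
    by (rule cover_num_attained[of "strong_power \<Theta> t" T])
      (simp_all add: vset_\<Theta> finite_V max_indep_or_power(3)[OF T(1)])
  have "card C \<le> max_cover t"
    unfolding max_cover_def C(3) by (intro Max_ge finite_imageI max_indep_or_power) (use T in auto)
  \<comment> \<open>The cover of this particular \<open>T\<close> may have fewer than
    \<open>g t\<close> centers, so it is padded to exactly \<open>max_cover t\<close> words.\<close>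
  from exists_subset_between[OF this max_cover_le_card C(1) finite_V]
  obtain C' where C': "C \<subseteq> C'" "C' \<subseteq> words X t" "card C' = max_cover t" by blast
  have "closed_nbhd_set (strong_power \<Theta> t) C \<subseteq> closed_nbhd_set (strong_power \<Theta> t) C'"
    using C'(1) by (auto simp: closed_nbhd_set_def)
  then have "S \<subseteq> closed_nbhd_set (strong_power \<Theta> t) C'"
    using T(2) C(2) by blast
  from max_guess_ge_cover[OF assms(1) C'(2) this _ assms(3)] show ?thesis
    using g_bounds[OF assms(1)] C'(3) by simp
qed

text \<open>All words together form a cover carrying mass 1, so the best \<open>g t\<close> of them
  capture a positive part.\<close>

lemma max_guess_word_prob_pos:
  assumes "t \<ge> 1" "set_pmf p \<subseteq> X"
  shows "0 < max_guess t (word_prob p)"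
proof -
  let ?V = "words X t"
  have "?V \<subseteq> closed_nbhd_set (strong_power \<Theta> t) ?V"
    using closed_nbhd_self[of _ "strong_power \<Theta> t"] by (auto simp: closed_nbhd_set_def vset_\<Theta>)
  then have "real (g t) * sum (word_prob p) ?V \<le> real (card ?V) * max_guess t (word_prob p)"
    using g_bounds(2)[OF assms(1)] max_cover_le_card[of t]
    by (intro max_guess_ge_cover assms word_prob_nonneg) auto
  then have "real (g t) \<le> real (card ?V) * max_guess t (word_prob p)"
    by (simp add: sum_word_prob_words[OF finite_X assms(2)])
  with g_bounds(1)[OF assms(1)] have "0 < real (card ?V) * max_guess t (word_prob p)" by linarith
  then show ?thesis by (simp add: zero_less_mult_iff)
qed

lemma sum_kernel:
  assumes "valid_mapping \<Gamma> t Y W" "xs \<in> words X t"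
  shows "(\<Sum>y\<in>Y. pmf (W xs) y) = 1"
  using assms by (intro sum_pmf_eq_1) (auto simp: valid_mapping_def vset_\<Gamma>)

text \<open>Using the optimal blind guess for every code symbol already recovers the
  denominator.\<close>

lemma leakage_ratio_ge_1:
  assumes "t \<ge> 1" "valid_mapping \<Gamma> t Y W" "set_pmf p \<subseteq> X"
  shows "1 \<le> leakage_ratio t Y W p"
proof -
  obtain K where K: "K \<subseteq> words X t" "card K = g t"
    "max_guess t (word_prob p) = sum (word_prob p) (closed_nbhd_set (strong_power \<Theta> t) K)"
    by (rule max_guess_attained[OF assms(1)])
  let ?N = "closed_nbhd_set (strong_power \<Theta> t) K"
  have "sum (word_prob p) ?N = (\<Sum>xs\<in>?N. \<Sum>y\<in>Y. word_prob p xs * pmf (W xs) y)"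
    using sum_kernel[OF assms(2)] guess_set_subset[of t K]
    by (intro sum.cong refl) (auto simp: sum_distrib_left[symmetric])
  also have "\<dots> = (\<Sum>y\<in>Y. \<Sum>xs\<in>?N. word_prob p xs * pmf (W xs) y)" by (rule sum.swap)
  also have "\<dots> \<le> (\<Sum>y\<in>Y. max_guess t (\<lambda>xs. word_prob p xs * pmf (W xs) y))"
    by (intro sum_mono guess_le_max_guess K)
  finally show ?thesis
    using max_guess_word_prob_pos[OF assms(1,3)] by (simp add: leakage_ratio_def K(3))
qed

text \<open>For each symbol any guess captures at most \<open>\<beta>\<close> times the blind
  guessing mass; summing over \<open>Y\<close> gives the factor \<open>card Y\<close>.\<close>

lemma leakage_ratio_le:
  assumes "t \<ge> 1" "set_pmf p \<subseteq> X" "\<And>xs y. xs \<in> words X t \<Longrightarrow> y \<in> Y \<Longrightarrow> pmf (W xs) y \<le> \<beta>"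
  shows "leakage_ratio t Y W p \<le> real (card Y) * \<beta>"
proof -
  have "max_guess t (\<lambda>xs. word_prob p xs * pmf (W xs) y) \<le> \<beta> * max_guess t (word_prob p)"
    if y: "y \<in> Y" for y
  proof -
    obtain K where K: "K \<subseteq> words X t" "card K = g t"
      "max_guess t (\<lambda>xs. word_prob p xs * pmf (W xs) y)
        = (\<Sum>xs\<in>closed_nbhd_set (strong_power \<Theta> t) K. word_prob p xs * pmf (W xs) y)"
      by (rule max_guess_attained[OF assms(1)])
    let ?N = "closed_nbhd_set (strong_power \<Theta> t) K"
    note K(3)
    also have "(\<Sum>xs\<in>?N. word_prob p xs * pmf (W xs) y) \<le> (\<Sum>xs\<in>?N. word_prob p xs * \<beta>)"
      using guess_set_subset[of t K] y by (intro sum_mono mult_left_mono assms(3) word_prob_nonneg) auto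
    also have "\<dots> = \<beta> * sum (word_prob p) ?N" by (simp add: sum_distrib_left mult.commute)
    also have "\<dots> \<le> \<beta> * max_guess t (word_prob p)"
    proof (rule mult_left_mono[OF guess_le_max_guess[OF K(1,2)]])
      \<comment> \<open>\<open>\<beta>\<close> is nonnegative because it bounds a probability at
        some word; one exists since the total mass is 1.\<close>
      obtain xs where "xs \<in> words X t"
        using sum_word_prob_words[OF finite_X assms(2), of t] by (cases "words X t = {}") auto
      then show "0 \<le> \<beta>" using assms(3)[OF _ y] pmf_nonneg order_trans by metis
    qed
    finally show ?thesis .
  qed
  then have "(\<Sum>y\<in>Y. max_guess t (\<lambda>xs. word_prob p xs * pmf (W xs) y))
      \<le> (\<Sum>y\<in>Y. \<beta> * max_guess t (word_prob p))" by (rule sum_mono)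
  then show ?thesis
    using max_guess_word_prob_pos[OF assms(1,2)] by (simp add: leakage_ratio_def field_simps)
qed

lemma sources_nonempty: "{p. set_pmf p \<subseteq> X} \<noteq> {}"
proof -
  obtain x where "x \<in> X" using X_nonempty by blast
  then have "return_pmf x \<in> {p. set_pmf p \<subseteq> X}" by simp
  then show ?thesis by blast
qed

text \<open>Every ratio is at most \<open>card Y\<close>, by \<open>leakage_ratio_le\<close> with
  \<open>\<beta> = 1\<close>; so the supremum is finite and a single source bounds it from
  below.\<close>

lemma leakage_ge:
  assumes "t \<ge> 1" "valid_mapping \<Gamma> t Y W" "set_pmf p \<subseteq> X" "0 < r" "r \<le> leakage_ratio t Y W p"
  shows "log c r \<le> leakage c \<Theta> g t Y W"
proof -
  have "bdd_above (leakage_ratio t Y W ` {p. set_pmf p \<subseteq> X})"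
    by (rule bdd_aboveI[of _ "real (card Y) * 1"])
      (auto intro!: leakage_ratio_le[OF assms(1), where \<beta> = 1, simplified] simp: pmf_le_1)
  then have "leakage_ratio t Y W p \<le> (SUP p\<in>{p. set_pmf p \<subseteq> X}. leakage_ratio t Y W p)"
    using assms(3) by (intro cSUP_upper) auto
  then show ?thesis unfolding leakage_eq using assms(4,5) c_gt_1 by (intro log_mono) auto
qed

lemma leakage_nonneg:
  assumes "t \<ge> 1" "valid_mapping \<Gamma> t Y W"
  shows "0 \<le> leakage c \<Theta> g t Y W"
proof -
  obtain p where "set_pmf p \<subseteq> X" using sources_nonempty by blast
  from leakage_ge[OF assms this zero_less_one leakage_ratio_ge_1[OF assms this]]
  show ?thesis by simp
qed

lemma leakage_le:
  assumes "t \<ge> 1" "valid_mapping \<Gamma> t Y W"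
    and "\<And>xs y. xs \<in> words X t \<Longrightarrow> y \<in> Y \<Longrightarrow> pmf (W xs) y \<le> \<beta>"
  shows "leakage c \<Theta> g t Y W \<le> log c (real (card Y) * \<beta>)"
proof -
  have *: "leakage_ratio t Y W p \<le> real (card Y) * \<beta>" if "set_pmf p \<subseteq> X" for p
    by (rule leakage_ratio_le) (use assms that in auto)
  \<comment> \<open>One source with ratio at least 1 makes the supremum positive, as monotonicity of
    the logarithm requires.\<close>
  have "bdd_above (leakage_ratio t Y W ` {p. set_pmf p \<subseteq> X})"
    by (rule bdd_aboveI) (use * in auto)
  moreover obtain p where p: "set_pmf p \<subseteq> X" using sources_nonempty by blast
  ultimately have "leakage_ratio t Y W p \<le> (SUP p\<in>{p. set_pmf p \<subseteq> X}. leakage_ratio t Y W p)"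
    by (intro cSUP_upper) auto
  with leakage_ratio_ge_1[OF assms(1,2) p]
  have "0 < (SUP p\<in>{p. set_pmf p \<subseteq> X}. leakage_ratio t Y W p)" by linarith
  moreover have "(SUP p\<in>{p. set_pmf p \<subseteq> X}. leakage_ratio t Y W p) \<le> real (card Y) * \<beta>"
    by (intro cSUP_least sources_nonempty) (use * in auto)
  ultimately show ?thesis unfolding leakage_eq using c_gt_1 by (intro log_mono) auto
qed

section \<open>Upper bound from fractional colorings\<close>

text \<open>The singletons of all letters are independent and add exactly one fold, so the least
  size in \<open>chi_fold\<close> is attained.\<close>

lemma fold_colouring_exists:
  "\<exists>M. (\<forall>S\<in>#M. indep_set \<Gamma> S) \<and> (\<forall>v\<in>X. size {#S \<in># M. v \<in> S#} = b)"
proof (induction b)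
  case 0
  show ?case by (rule exI[of _ "{#}"]) simp
next
  case (Suc b)
  then obtain M where M: "\<forall>S\<in>#M. indep_set \<Gamma> S" "\<forall>v\<in>X. size {#S \<in># M. v \<in> S#} = b" by blast
  let ?L = "image_mset (\<lambda>v. {v}) (mset_set X)"
  have "size {#S \<in># ?L. v \<in> S#} = 1" if "v \<in> X" for v
  proof -
    have "{x \<in> X. v = x} = {v}" using that by auto
    then show ?thesis using finite_X by (simp add: filter_mset_image_mset filter_mset_mset_set)
  qed
  then show ?case
    using M indep_set_singleton[OF graph_\<Gamma>] finite_X vset_\<Gamma>
    by (intro exI[of _ "M + ?L"]) auto
qed

text \<open>A list replaces the multiset: repeated independent sets get distinct indices, and these
  serve as code letters.\<close>

lemma chi_fold_attained:
  obtains Ss where "length Ss = chi_fold \<Gamma> b" "\<And>S. S \<in> set Ss \<Longrightarrow> indep_set \<Gamma> S"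
    "\<And>v. v \<in> X \<Longrightarrow> card {k. k < length Ss \<and> v \<in> Ss ! k} = b"
proof -
  let ?P = "\<lambda>m. \<exists>M :: 'a set multiset. size M = m \<and>
     (\<forall>S\<in>#M. indep_set \<Gamma> S) \<and> (\<forall>v\<in>vset \<Gamma>. size {#S \<in># M. v \<in> S#} = b)"
  from fold_colouring_exists[of b] obtain m where "?P m" by (auto simp: vset_\<Gamma>)
  then have "?P (chi_fold \<Gamma> b)" unfolding chi_fold_def by (rule LeastI)
  then obtain M where M: "size M = chi_fold \<Gamma> b" "\<forall>S\<in>#M. indep_set \<Gamma> S"
    "\<forall>v\<in>X. size {#S \<in># M. v \<in> S#} = b" by (auto simp: vset_\<Gamma>)
  obtain Ss where Ss: "mset Ss = M" using ex_mset by blast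
  show ?thesis
  proof (rule that[of Ss])
    show "length Ss = chi_fold \<Gamma> b" using M(1) Ss by auto
    show "indep_set \<Gamma> S" if "S \<in> set Ss" for S using M(2) Ss that by auto
    show "card {k. k < length Ss \<and> v \<in> Ss ! k} = b" if "v \<in> X" for v
    proof -
      have "card {k. k < length Ss \<and> v \<in> Ss ! k} = length (filter (\<lambda>S. v \<in> S) Ss)"
        by (simp add: length_filter_conv_card)
      also have "\<dots> = size {#S \<in># M. v \<in> S#}"
        by (simp add: Ss[symmetric] size_mset[symmetric] del: size_mset)
      finally show ?thesis using M(3) that by simp
    qed
  qed
qed

text \<open>The mapping draws uniformly from \<open>B xs\<close>, the \<open>b ^ t\<close> index
  tuples whose sets contain the letters of \<open>xs\<close>; each of the \<open>m ^ t\<close>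
  symbols then has conditional probability at most \<open>1 / b ^ t\<close>.\<close>

lemma colouring_mapping:
  assumes "t \<ge> 1" "b \<ge> 1"
  obtains Y W where "valid_mapping \<Gamma> t Y W"
    "leakage c \<Theta> g t Y W \<le> real t * log c (real (chi_fold \<Gamma> b) / real b)"
proof -
  obtain Ss where Ss: "length Ss = chi_fold \<Gamma> b" "\<And>S. S \<in> set Ss \<Longrightarrow> indep_set \<Gamma> S"
    "\<And>v. v \<in> X \<Longrightarrow> card {k. k < length Ss \<and> v \<in> Ss ! k} = b"
    by (rule chi_fold_attained[of b]) blast
  define m where "m = length Ss"
  define B where "B xs = word_box (\<lambda>j. {k. k < m \<and> xs ! j \<in> Ss ! k}) t" for xs
  define Y where "Y = (to_nat :: nat list \<Rightarrow> nat) ` words {..<m} t"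
  define W where "W xs = map_pmf to_nat (pmf_of_set (B xs))" for xs
  have card_B: "card (B xs) = b ^ t" if "xs \<in> words X t" for xs
    using Ss(3) nth_words[OF that] by (simp add: B_def card_word_box m_def)
  have fin_B: "finite (B xs)" for xs by (simp add: B_def finite_word_box)
  have ne_B: "B xs \<noteq> {}" if "xs \<in> words X t" for xs
    using card_B[OF that] assms(2) by auto
  have sub_B: "B xs \<subseteq> words {..<m} t" for xs
    by (auto simp: B_def words_eq_word_box word_box_def)
  have pmf_W: "pmf (W xs) (to_nat ks) = indicator (B xs) ks / real (b ^ t)"
    if "xs \<in> words X t" for xs ks
    unfolding W_def using that
    by (simp add: pmf_map_inj' pmf_of_set[OF ne_B[OF that] fin_B] card_B)
  have valid: "valid_mapping \<Gamma> t Y W"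
    unfolding valid_mapping_def vset_\<Gamma>
  proof (intro conjI ballI)
    show "finite Y" by (simp add: Y_def finite_words)
    show "set_pmf (W xs) \<subseteq> Y" if "xs \<in> words X t" for xs
      using ne_B[OF that] fin_B sub_B by (auto simp: W_def Y_def)
    fix y assume "y \<in> Y"
    then obtain ks where ks: "ks \<in> words {..<m} t" "y = to_nat ks" by (auto simp: Y_def)
    \<comment> \<open>Every word that can produce \<open>ks\<close> has its \<open>j\<close>-th
      letter in \<open>Ss ! (ks ! j)\<close>, so these words lie in a box of independent
      sets.\<close>
    have "indep_set (or_power \<Gamma> t) (word_box (\<lambda>j. Ss ! (ks ! j)) t)"
      using Ss(2) nth_words[OF ks(1)] by (intro indep_set_or_power) (simp add: m_def)
    moreover have "xs \<in> word_box (\<lambda>j. Ss ! (ks ! j)) t"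
      if "xs \<in> words X t" "pmf (W xs) y > 0" for xs
    proof -
      have "ks \<in> B xs" using that by (cases "ks \<in> B xs") (simp_all add: ks(2) pmf_W)
      then show ?thesis using that(1) by (auto simp: B_def word_box_def words_def)
    qed
    ultimately show "indep_set (or_power \<Gamma> t) {xs \<in> words X t. pmf (W xs) y > 0}"
      unfolding indep_set_def by blast
  qed
  have "leakage c \<Theta> g t Y W \<le> log c (real (card Y) * (1 / real (b ^ t)))"
    by (rule leakage_le[OF assms(1) valid]) (auto simp: Y_def pmf_W indicator_def)
  also have "card Y = m ^ t" by (simp add: Y_def card_image card_words)
  also have "real (m ^ t) * (1 / real (b ^ t)) = (real m / real b) ^ t" by (simp add: power_divide)
  also have "log c \<dots> = real t * log c (real m / real b)"
  proof -
    obtain x where "x \<in> X" using X_nonempty by blast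
    then have "m > 0" using Ss(3)[of x] assms(2) by (cases "m = 0") (auto simp: m_def)
    then show ?thesis using assms(2) by (intro log_nat_power) auto
  qed
  finally show ?thesis using valid that by (simp add: m_def Ss(1))
qed

lemma normalized_leakage_le:
  assumes "t \<ge> 1" "b \<ge> 1"
  shows "normalized_leakage c \<Gamma> \<Theta> g t \<le> log c (real (chi_fold \<Gamma> b) / real b)"
proof -
  obtain Y W where YW: "valid_mapping \<Gamma> t Y W"
    "leakage c \<Theta> g t Y W \<le> real t * log c (real (chi_fold \<Gamma> b) / real b)"
    by (rule colouring_mapping[OF assms])
  have "Inf {leakage c \<Theta> g t Y W | Y W. valid_mapping \<Gamma> t Y W} \<le> leakage c \<Theta> g t Y W"
  proof (rule cInf_lower)
    show "bdd_below {leakage c \<Theta> g t Y W | Y W. valid_mapping \<Gamma> t Y W}"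
      by (rule bdd_belowI[of _ 0]) (use leakage_nonneg[OF assms(1)] in auto)
  qed (use YW(1) in blast)
  also note YW(2)
  finally show ?thesis using assms(1) by (simp add: normalized_leakage_def field_simps)
qed

lemma normalized_leakage_ge:
  assumes "t \<ge> 1" "\<And>Y W. valid_mapping \<Gamma> t Y W \<Longrightarrow> real t * r \<le> leakage c \<Theta> g t Y W"
  shows "r \<le> normalized_leakage c \<Gamma> \<Theta> g t"
proof -
  \<comment> \<open>The coloring mapping for \<open>b = 1\<close> shows that the infimum is over a
    nonempty set.\<close>
  obtain Y W where "valid_mapping \<Gamma> t Y W"
    by (rule colouring_mapping[OF assms(1) order_refl])
  then have "real t * r \<le> Inf {leakage c \<Theta> g t Y W | Y W. valid_mapping \<Gamma> t Y W}"
    by (intro cInf_greatest) (use assms(2) in auto)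
  then show ?thesis using assms(1) by (simp add: normalized_leakage_def field_simps)
qed

section \<open>Lower bound from fractional packings\<close>

text \<open>The total mass 1 is split among the code symbols; the part of each symbol sits on an
  independent set, where \<open>max_guess_ge_indep\<close> applies.\<close>

lemma guess_mass_ge:
  assumes "t \<ge> 1" "valid_mapping \<Gamma> t Y W" "set_pmf p \<subseteq> X"
  shows "real (g t) \<le> real (max_cover t)
    * (\<Sum>y\<in>Y. max_guess t (\<lambda>xs. word_prob p xs * pmf (W xs) y))"
proof -
  let ?f = "\<lambda>y xs. word_prob p xs * pmf (W xs) y"
  let ?S = "\<lambda>y. {xs \<in> words X t. pmf (W xs) y > 0}"
  have "1 = (\<Sum>xs\<in>words X t. \<Sum>y\<in>Y. ?f y xs)"
    using sum_kernel[OF assms(2)] sum_word_prob_words[OF finite_X assms(3), of t]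
    by (simp add: sum_distrib_left[symmetric])
  also have "\<dots> = (\<Sum>y\<in>Y. sum (?f y) (words X t))" by (rule sum.swap)
  also have "\<dots> = (\<Sum>y\<in>Y. sum (?f y) (?S y))"
    by (intro sum.cong refl sum.mono_neutral_right finite_V)
      (auto simp: zero_less_iff_neq_zero less_le)
  finally have "real (g t) = (\<Sum>y\<in>Y. real (g t) * sum (?f y) (?S y))"
    by (simp add: sum_distrib_left[symmetric])
  also have "\<dots> \<le> (\<Sum>y\<in>Y. real (max_cover t) * max_guess t (?f y))"
    using assms(1,2)
    by (intro sum_mono max_guess_ge_indep mult_nonneg_nonneg word_prob_nonneg pmf_nonneg)
      (auto simp: valid_mapping_def vset_\<Gamma>)
  finally show ?thesis by (simp add: sum_distrib_left)
qed

text \<open>A union bound over the guessed words; the mass of each neighborhood is a product of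
  single-letter neighborhood masses.\<close>

lemma max_guess_word_prob_le:
  assumes "t \<ge> 1" "set_pmf p \<subseteq> X" "\<And>x. x \<in> X \<Longrightarrow> (\<Sum>y\<in>closed_nbhd \<Theta> x. pmf p y) \<le> r"
  shows "max_guess t (word_prob p) \<le> real (g t) * r ^ t"
proof -
  obtain K where K: "K \<subseteq> words X t" "card K = g t"
    "max_guess t (word_prob p) = sum (word_prob p) (closed_nbhd_set (strong_power \<Theta> t) K)"
    by (rule max_guess_attained[OF assms(1)])
  have finK: "finite K" using K(1) finite_V finite_subset by blast
  note K(3)
  also have "sum (word_prob p) (closed_nbhd_set (strong_power \<Theta> t) K)
      \<le> (\<Sum>xs\<in>K. sum (word_prob p) (closed_nbhd (strong_power \<Theta> t) xs))"
    unfolding closed_nbhd_set_def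
    using finK word_prob_nonneg
    by (intro sum_UN_le finite_subset[OF closed_nbhd_subset]) (auto simp: vset_\<Theta> finite_V)
  also have "\<dots> \<le> (\<Sum>xs\<in>K. r ^ t)"
  proof (rule sum_mono)
    fix xs assume "xs \<in> K"
    then have xs: "xs \<in> words X t" using K(1) by blast
    have "sum (word_prob p) (closed_nbhd (strong_power \<Theta> t) xs)
        = (\<Prod>j<t. \<Sum>y\<in>closed_nbhd \<Theta> (xs ! j). pmf p y)"
      using xs by (simp add: closed_nbhd_strong_power vset_\<Theta> sum_word_prob_word_box)
    also have "\<dots> \<le> (\<Prod>j<t. r)"
      using assms(3) nth_words[OF xs] by (intro prod_mono) (auto intro: sum_nonneg)
    finally show "sum (word_prob p) (closed_nbhd (strong_power \<Theta> t) xs) \<le> r ^ t" by simp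
  qed
  finally show ?thesis by (simp add: K(2))
qed

lemma source_from_packing:
  assumes "\<And>x. x \<in> X \<Longrightarrow> 0 \<le> l x" "0 < sum l X"
  obtains p where "set_pmf p \<subseteq> X" "\<And>x. x \<in> X \<Longrightarrow> pmf p x = l x / sum l X"
proof -
  define f where "f x = (if x \<in> X then l x / sum l X else 0)" for x
  have nonneg: "0 \<le> f x" for x using assms by (simp add: f_def)
  have "(\<integral>\<^sup>+ x. ennreal (f x) \<partial>count_space UNIV) = (\<Sum>x\<in>X. ennreal (f x))"
    by (rule nn_integral_count_space') (auto simp: finite_X f_def)
  also have "\<dots> = ennreal (\<Sum>x\<in>X. f x)" using nonneg by (simp add: sum_ennreal)
  also have "(\<Sum>x\<in>X. f x) = 1" using assms(2) by (simp add: f_def sum_divide_distrib[symmetric])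
  finally have f: "(\<integral>\<^sup>+ x. ennreal (f x) \<partial>count_space UNIV) = 1" by simp
  show ?thesis
    by (rule that[of "embed_pmf f"])
      (auto simp: pmf_embed_pmf[OF nonneg f] set_embed_pmf[OF nonneg f] f_def)
qed

text \<open>The normalized packing gives each neighborhood mass at most \<open>1 / sum l X\<close>,
  so the blind guessing mass is at most \<open>g t / (sum l X) ^ t\<close>. Against a numerator of
  at least \<open>g t / max_cover t\<close> the number of guesses cancels. The factor
  \<open>real t\<close> is pulled out to fit \<open>normalized_leakage_ge\<close>.\<close>

lemma leakage_ge_packing:
  assumes "t \<ge> 1" "valid_mapping \<Gamma> t Y W"
    and l: "\<And>x. x \<in> X \<Longrightarrow> 0 \<le> l x" "\<And>x. x \<in> X \<Longrightarrow> (\<Sum>y\<in>closed_nbhd \<Theta> x. l y) \<le> 1"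
      "0 < sum l X"
    and "1 \<le> q" "\<And>T. T \<in> max_indep_sets \<Gamma> \<Longrightarrow> frac_cover_num (assoc_hypergraph \<Theta> T) < q"
  shows "real t * (log c (sum l X / q) - log c (real t * ln (real (card X)) + 2) / real t)
    \<le> leakage c \<Theta> g t Y W"
proof -
  let ?s = "sum l X" and ?E = "real t * ln (real (card X)) + 2"
  obtain p where p: "set_pmf p \<subseteq> X" "\<And>x. x \<in> X \<Longrightarrow> pmf p x = l x / ?s"
    using source_from_packing[OF l(1,3)] by blast
  let ?num = "\<Sum>y\<in>Y. max_guess t (\<lambda>xs. word_prob p xs * pmf (W xs) y)"
  let ?den = "max_guess t (word_prob p)"
  have "card X \<ge> 1" using X_nonempty finite_X by (simp add: Suc_leI card_gt_0_iff)
  then have E: "0 < ?E" by (simp add: add_nonneg_pos)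
  have den_pos: "0 < ?den" by (rule max_guess_word_prob_pos[OF assms(1) p(1)])
  have "?den \<le> real (g t) * (1 / ?s) ^ t"
  proof (rule max_guess_word_prob_le[OF assms(1) p(1)])
    fix x assume x: "x \<in> X"
    have "(\<Sum>y\<in>closed_nbhd \<Theta> x. pmf p y) = (\<Sum>y\<in>closed_nbhd \<Theta> x. l y) / ?s"
      unfolding sum_divide_distrib
      using closed_nbhd_subset[of \<Theta> x] vset_\<Theta> by (intro sum.cong p(2)) auto
    then show "(\<Sum>y\<in>closed_nbhd \<Theta> x. pmf p y) \<le> 1 / ?s"
      using l(2)[OF x] l(3) by (simp add: divide_right_mono)
  qed
  then have den: "?s ^ t * ?den \<le> real (g t)"
    using l(3) by (simp add: power_one_over field_simps)
  have num: "real (g t) \<le> real (max_cover t) * ?num"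
    by (rule guess_mass_ge[OF assms(1,2) p(1)])
  obtain T where T: "T \<in> max_indep_sets (or_power \<Gamma> t)"
    "max_cover t = cover_num (assoc_hypergraph (strong_power \<Theta> t) T)"
    by (rule max_cover_attained)
  have cover: "real (max_cover t) \<le> q ^ t * ?E"
    using cover_num_or_power_le[OF graph_\<Gamma> graph_\<Theta> _ _ assms(6,7) T(1)] X_nonempty
    by (simp add: T(2) vset_\<Gamma> vset_\<Theta>)
  have "1 \<le> ?num / ?den"
    using leakage_ratio_ge_1[OF assms(1,2) p(1)] by (simp add: leakage_ratio_def)
  then have "0 \<le> ?num" using den_pos by (simp add: field_simps)
  then have "real (max_cover t) * ?num \<le> (q ^ t * ?E) * ?num"
    by (rule mult_right_mono[OF cover])
  with den num have "?s ^ t * ?den \<le> (q ^ t * ?E) * ?num" by linarith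
  then have ratio: "(?s / q) ^ t / ?E \<le> leakage_ratio t Y W p"
  proof -
    have "a / b \<le> n / d" if "a * d \<le> b * n" "0 < b" "0 < d" for a b n d :: real
      using that by (simp add: field_simps)
    from this[OF \<open>?s ^ t * ?den \<le> (q ^ t * ?E) * ?num\<close> _ den_pos]
    have "?s ^ t / (q ^ t * ?E) \<le> ?num / ?den" using E assms(6) by simp
    then show ?thesis by (simp add: leakage_ratio_def power_divide)
  qed
  have sq: "0 < ?s / q" using l(3) assms(6) by simp
  have "log c ((?s / q) ^ t / ?E) \<le> leakage c \<Theta> g t Y W"
    by (rule leakage_ge[OF assms(1,2) p(1) _ ratio]) (use sq E in simp)
  moreover have "log c ((?s / q) ^ t / ?E) = real t * log c (?s / q) - log c ?E"
    using sq E c_gt_1 by (subst log_divide_pos) (simp_all add: log_nat_power)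
  ultimately show ?thesis using assms(1) by (simp add: algebra_simps)
qed

section \<open>Passage to the limit\<close>

lemma log_linear_over_n_tendsto_0:
  assumes "0 \<le> A"
  shows "(\<lambda>t. log c (real t * A + 2) / real t) \<longlonglongrightarrow> 0"
proof (cases "A = 0")
  \<comment> \<open>This is the one-letter alphabet, where the argument of the logarithm stays
    constant.\<close>
  case True
  then show ?thesis by simp real_asymp
next
  case False
  with assms have "0 < A" by simp
  have "(\<lambda>t. ln (real t * A + 2) / real t) \<longlonglongrightarrow> 0"
    using \<open>0 < A\<close> by real_asymp
  from tendsto_divide[OF this tendsto_const[of "ln c"]] show ?thesis
    using c_gt_1 by (simp add: log_def field_simps)
qed

text \<open>In exponential form the supremum over packings and the passage of \<open>q\<close> to
  its limit need no logarithm, and packings of weight zero are harmless.\<close>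

lemma rate_ge_packing:
  assumes lim: "normalized_leakage c \<Gamma> \<Theta> g \<longlonglongrightarrow> L"
    and l: "\<And>x. x \<in> X \<Longrightarrow> 0 \<le> l x" "\<And>x. x \<in> X \<Longrightarrow> (\<Sum>y\<in>closed_nbhd \<Theta> x. l y) \<le> 1"
    and q: "1 \<le> q" "\<And>T. T \<in> max_indep_sets \<Gamma> \<Longrightarrow> frac_cover_num (assoc_hypergraph \<Theta> T) < q"
  shows "sum l X \<le> q * c powr L"
proof (cases "0 < sum l X")
  case True
  let ?A = "ln (real (card X))"
  have "card X \<ge> 1" using X_nonempty finite_X by (simp add: Suc_leI card_gt_0_iff)
  then have "0 \<le> ?A" by simp
  have "(\<lambda>t. log c (sum l X / q) - log c (real t * ?A + 2) / real t) \<longlonglongrightarrow> log c (sum l X / q) - 0"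
    by (intro tendsto_diff tendsto_const log_linear_over_n_tendsto_0) fact
  moreover have "log c (sum l X / q) - log c (real t * ?A + 2) / real t
      \<le> normalized_leakage c \<Gamma> \<Theta> g t" if "t \<ge> 1" for t
    using normalized_leakage_ge[OF that] leakage_ge_packing[OF that _ l True q] by blast
  ultimately have "log c (sum l X / q) - 0 \<le> L"
    using lim by (intro LIMSEQ_le[OF _ lim]) auto
  then have "sum l X / q \<le> c powr L"
    using True q(1) c_gt_1 by (simp add: log_le_iff)
  then show ?thesis using q(1) by (simp add: field_simps)
next
  case False
  moreover have "0 \<le> q * c powr L" using q(1) by simp
  ultimately show ?thesis by linarith
qed

lemma rate_lower_bound:
  assumes lim: "normalized_leakage c \<Gamma> \<Theta> g \<longlonglongrightarrow> L"
  shows "log c (frac_packing \<Theta> /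
      Max ((\<lambda>T. frac_cover_num (assoc_hypergraph \<Theta> T)) ` max_indep_sets \<Gamma>)) \<le> L"
proof -
  let ?k = "\<lambda>T. frac_cover_num (assoc_hypergraph \<Theta> T)"
  define P where "P = {\<Sum>x\<in>vset \<Theta>. l x | l :: 'a \<Rightarrow> real. (\<forall>x\<in>vset \<Theta>. 0 \<le> l x \<and> l x \<le> 1) \<and>
     (\<forall>x\<in>vset \<Theta>. (\<Sum>y\<in>closed_nbhd \<Theta> x. l y) \<le> 1)}"
  have packing: "frac_packing \<Theta> = Sup P" unfolding frac_packing_def P_def ..
  define K where "K = Max (?k ` max_indep_sets \<Gamma>)"
  have fin: "finite (max_indep_sets \<Gamma>)"
    by (rule finite_max_indep_sets) (simp add: vset_\<Gamma> finite_X)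
  have k_le: "?k T \<le> K" if "T \<in> max_indep_sets \<Gamma>" for T
    unfolding K_def using fin that by (intro Max_ge) auto
  obtain T where T: "T \<in> max_indep_sets \<Gamma>"
    using max_indep_sets_nonempty[of \<Gamma>] finite_X vset_\<Gamma> by auto
  have "T \<subseteq> X" using T by (simp add: max_indep_sets_def indep_set_def vset_\<Gamma>)
  then have "1 \<le> ?k T"
    using max_indep_set_nonempty[OF graph_\<Gamma> _ T] X_nonempty finite_subset[OF _ finite_X]
    by (intro frac_cover_num_ge_1) (simp_all add: vset_\<Gamma> vset_\<Theta>)
  then have K: "1 \<le> K" using k_le[OF T] by linarith
  \<comment> \<open>The packing concentrated on one letter shows that \<open>P\<close> is nonempty
    with supremum at least 1, hence positive.\<close>
  obtain x0 where x0: "x0 \<in> X" using X_nonempty by blast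
  let ?l = "\<lambda>x. if x = x0 then 1 else 0 :: real"
  have "sum ?l A \<le> 1" if "A \<subseteq> X" for A
    using finite_subset[OF that finite_X] by simp
  then have "sum ?l (closed_nbhd \<Theta> x) \<le> 1" for x
    using closed_nbhd_subset[of \<Theta> x] vset_\<Theta> by blast
  then have "sum ?l (vset \<Theta>) \<in> P"
    unfolding P_def mem_Collect_eq by (intro exI[of _ ?l] conjI ballI refl) auto
  moreover have "sum ?l (vset \<Theta>) = 1" using x0 finite_X by (simp add: vset_\<Theta>)
  ultimately have mem: "1 \<in> P" by simp
  have bound: "s \<le> q * c powr L" if "s \<in> P" "K < q" for s q
  proof -
    obtain l where l: "s = sum l X" "\<forall>x\<in>X. 0 \<le> l x" "\<forall>x\<in>X. (\<Sum>y\<in>closed_nbhd \<Theta> x. l y) \<le> 1"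
      using \<open>s \<in> P\<close> unfolding P_def vset_\<Theta> by blast
    show ?thesis unfolding l(1)
    proof (rule rate_ge_packing[OF lim])
      show "1 \<le> q" using K \<open>K < q\<close> by linarith
      show "?k T < q" if "T \<in> max_indep_sets \<Gamma>" for T
        using k_le[OF that] \<open>K < q\<close> by linarith
    qed (use l(2,3) in blast)+
  qed
  \<comment> \<open>The rate bound itself, at \<open>q = K + 1\<close>, bounds all packings.\<close>
  have "bdd_above P" by (rule bdd_aboveI[of _ "(K + 1) * c powr L"], rule bound) auto
  then have p_ge: "1 \<le> frac_packing \<Theta>"
    unfolding packing by (rule cSup_upper[OF mem])
  \<comment> \<open>Cover weights are available only for \<open>q\<close> strictly above
    \<open>K\<close>, so \<open>K\<close> is approached from above.\<close>
  have "frac_packing \<Theta> / c powr L \<le> K"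
  proof (rule dense_ge)
    fix q assume "K < q"
    have "frac_packing \<Theta> \<le> q * c powr L"
      unfolding packing
    proof (rule cSup_least)
      show "P \<noteq> {}" using mem by blast
      show "s \<le> q * c powr L" if "s \<in> P" for s using that \<open>K < q\<close> by (rule bound)
    qed
    then show "frac_packing \<Theta> / c powr L \<le> q" using c_gt_1 by (simp add: field_simps)
  qed
  then have "frac_packing \<Theta> / K \<le> c powr L" using K c_gt_1 by (simp add: field_simps)
  then have "log c (frac_packing \<Theta> / K) \<le> L"
    using p_ge K c_gt_1 by (simp add: log_le_iff)
  then show ?thesis by (simp add: K_def)
qed

text \<open>For fixed \<open>b\<close> the coloring bound holds at every positive length and
  survives the limit. The infimum over \<open>b\<close> comes afterwards, in exponential form so
  that it is not exchanged with the logarithm.\<close>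

lemma rate_upper_bound:
  assumes lim: "normalized_leakage c \<Gamma> \<Theta> g \<longlonglongrightarrow> L"
  shows "L \<le> log c (chi_frac \<Gamma>)"
proof -
  have "c powr L \<le> real (chi_fold \<Gamma> b) / real b" if b: "b \<in> {1..}" for b
  proof -
    have "L \<le> log c (real (chi_fold \<Gamma> b) / real b)"
      by (rule LIMSEQ_le_const2[OF lim]) (use normalized_leakage_le b in auto)
    moreover have "0 < real (chi_fold \<Gamma> b) / real b"
    proof -
      obtain Ss where Ss: "length Ss = chi_fold \<Gamma> b"
        "\<And>v. v \<in> X \<Longrightarrow> card {k. k < length Ss \<and> v \<in> Ss ! k} = b"
        by (rule chi_fold_attained[of b]) blast
      obtain x where "x \<in> X" using X_nonempty by blast
      then have "chi_fold \<Gamma> b > 0" using Ss(2)[of x] b by (cases "chi_fold \<Gamma> b = 0") (auto simp: Ss(1))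
      then show ?thesis using b by simp
    qed
    ultimately show ?thesis using c_gt_1 by (simp add: le_log_iff)
  qed
  then have "c powr L \<le> chi_frac \<Gamma>"
    unfolding chi_frac_def by (intro cINF_greatest) auto
  moreover from this have "0 < chi_frac \<Gamma>"
    using c_gt_1 by (smt (verit) powr_gt_zero)
  ultimately show ?thesis using c_gt_1 by (simp add: le_log_iff)
qed

end

theorem theorem4:
  fixes \<Gamma> \<Theta> :: "'a sgraph" and X :: "'a set" and g :: "nat \<Rightarrow> nat" and c :: real
  assumes "simple_graph \<Gamma>" and "simple_graph \<Theta>"
    and "vset \<Gamma> = X" and "vset \<Theta> = X" and "X \<noteq> {}"
    and "guessing_capability \<Gamma> \<Theta> g"
    and "c > 1"
    and "convergent (normalized_leakage c \<Gamma> \<Theta> g)"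
  shows "log c (frac_packing \<Theta> /
             Max ((\<lambda>T. frac_cover_num (assoc_hypergraph \<Theta> T)) ` max_indep_sets \<Gamma>))
           \<le> leakage_rate c \<Gamma> \<Theta> g \<and>
         leakage_rate c \<Gamma> \<Theta> g \<le> log c (chi_frac \<Gamma>)"
proof -
  interpret guessing_setup \<Gamma> \<Theta> X g c
    using assms by unfold_locales
  have "normalized_leakage c \<Gamma> \<Theta> g \<longlonglongrightarrow> leakage_rate c \<Gamma> \<Theta> g"
    unfolding leakage_rate_def using assms(8) by (simp add: convergent_LIMSEQ_iff)
  then show ?thesis using rate_lower_bound rate_upper_bound by blast
qed

end
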